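(* Let $\Omega=\mathbb{S}_{+}^n\cap\Xi$ for a closed set $\Xi\subset\mathbb{S}^n$, let $r\in\{1,\ldots,n\}$, and suppose $\Gamma_r:=\{X\in\Omega\,|\,\mathrm{rank}(X)\le r\}$ is nonempty. Consider any $\overline{X}\in\Gamma_r$. The mapping $\mathcal{S}_r$ is calm at $0$ for $\overline{X}$ under either of the following equivalent conditions: (i) there exists a constant $\beta\ge0$ along with $\varepsilon>0$ such that for all $X\in\mathbb{S}^n$ with $\|X-\overline{X}\|_F\le\varepsilon$, $$\mathrm{dist}(X,\Gamma_r)\le\beta\big[\mathrm{dist}(X,\Xi)+\mathrm{dist}(X,\Lambda_r^{+})\big];$$ (ii) the multifunction $\mathcal{G}_r:\mathbb{S}^n\times\mathbb{S}^n\rightrightarrows\mathbb{S}^n$ defined by $\mathcal{G}_r(X,Y):=\{X-Y\}$ if $(X,Y)\in\Xi\times\Lambda_r^{+}$ and $\mathcal{G}_r(X,Y):=\emptyset$ otherwise is subregular at $(\overline{X},\overline{X})$ for the origin. Moreover, the calmness of $\mathcal{S}_r$ at $0$ for $\overline{X}$ is equivalent to either of conditions (i) and (ii) if in addition there exists a constant $\kappa'>0$ along with $\epsilon'>0$ such that for all $X\in\mathbb{S}^n$ with $\|X-\overline{X}\|_F\le\epsilon'$, $$\mathrm{dist}(X,\Omega)\le\kappa'\big[\mathrm{dist}(X,\Xi)+\mathrm{dist}(X,\mathbb{S}_{+}^n)\big].$$ Consequently, for any $\overline{X}\in\Gamma_r$, the calmness of $\mathcal{S}_r$ at $0$ for $\overline{X}$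 is implied by the condition $$[-\mathcal{N}_{\Xi}(\overline{X})]\cap\mathcal{N}_{\Lambda_r^{+}}(\overline{X})=\{0\}.$$
   Context: $\mathbb{S}^n$ is the space of $n\times n$ real symmetric matrices with the trace inner product and Frobenius norm $\|\cdot\|_F$; $\mathbb{S}_+^n$ is the cone of positive semidefinite matrices. $\Lambda_r^{+}:=\{X\in\mathbb{S}_+^n\,|\,\mathrm{rank}(X)\le r\}$. $\sigma_1(X)\ge\cdots\ge\sigma_n(X)$ are the singular values of $X$; $\|X\|_*=\sum_{i=1}^n\sigma_i(X)$ is the nuclear norm and $\|X\|_{(r)}=\sum_{i=1}^r\sigma_i(X)$ is the Ky-Fan $r$-norm. The multifunction $\mathcal{S}_r:\mathbb{R}\rightrightarrows\mathbb{S}^n$ is $\mathcal{S}_r(\tau):=\{X\in\Omega\,|\,\|X\|_*-\|X\|_{(r)}=\tau\}$, so $\mathcal{S}_r(0)=\Gamma_r$. $\mathrm{dist}(X,C)$ is the Frobenius-norm distance from $X$ to $C$, with $\mathrm{dist}(X,\emptyset)=+\infty$. Calmness: a multifunction $\mathcal{M}:\mathbb{Y}\rightrightarrows\mathbb{Z}$ between finite-dimensional Euclidean spaces is calm at $\overline{y}$ for $\overline{z}\in\mathcal{M}(\overline{y})$ if there exist $\gamma\ge0$, $\varepsilon>0$, $\delta>0$ such that for all $y$ with $\|y-\overline{y}\|\le\varepsilon$, $\mathcal{M}(y)\cap\mathbb{B}(\overline{z},\delta)\subseteq\mathcal{M}(\overline{y})+\gamma\|y-\overline{y}\|\mathbb{B}_{\mathbb{Z}}$,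 where $\mathbb{B}(\overline z,\delta)$ is the closed ball and $\mathbb{B}_{\mathbb{Z}}$ the closed unit ball. Subregularity: $\mathcal{F}:\mathbb{Z}\rightrightarrows\mathbb{Y}$ is (metrically) subregular at $\overline{z}$ for $\overline{y}\in\mathcal{F}(\overline{z})$ if there exist $\kappa\ge0$ and $\varepsilon>0$ such that $\mathrm{dist}(z,\mathcal{F}^{-1}(\overline{y}))\le\kappa\,\mathrm{dist}(\overline{y},\mathcal{F}(z))$ for all $z\in\mathbb{B}(\overline{z},\varepsilon)$. Normal cones: for a closed set $S\subseteq\mathbb{S}^n$ and $\overline{x}\in S$, the Fréchet normal cone is $\widehat{\mathcal{N}}_S(\overline{x}):=\{v\in\mathbb{S}^n\,|\,\limsup_{x\to\overline{x},\,x\in S,\,x\ne\overline{x}}\langle v,x-\overline{x}\rangle/\|x-\overline{x}\|\le0\}$, and the limiting normal cone $\mathcal{N}_S(\overline{x})$ is the set of $v$ for which there exist $x^k\in S$, $x^k\to\overline{x}$, and $v^k\in\widehat{\mathcal{N}}_S(x^k)$ with $v^k\to v$. *)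

theory Defs
  imports "HOL-Analysis.Analysis" "HOL-Computational_Algebra.Polynomial"
begin

section \<open>Symmetric matrices\<close>

text \<open>The space of n by n real symmetric matrices is a linear subspace of the type
  \<^typ>\<open>real^'n^'n\<close>, with n = \<^term>\<open>CARD('n)\<close>. The inner product and norm of that type
  are the trace inner product and the Frobenius norm.\<close>

definition sym_mats :: "(real^'n^'n) set" where
  "sym_mats = {X. transpose X = X}"

lemma inner_matrix_eq_trace:
  fixes A B :: "real^'n^'n"
  shows "A \<bullet> B = trace (transpose A ** B)"
  unfolding inner_vec_def trace_def matrix_matrix_mult_def transpose_def
  by (simp, rule sum.swap)

lemma norm_matrix_eq_Frobenius:
  fixes A :: "real^'n^'n"
  shows "norm A = sqrt (\<Sum>i\<in>UNIV. \<Sum>j\<in>UNIV. (A $ i $ j)\<^sup>2)"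
  unfolding norm_eq_sqrt_inner inner_vec_def by (simp add: power2_eq_square)

definition psd_cone :: "(real^'n^'n) set" where
  "psd_cone = {X \<in> sym_mats. \<forall>v. 0 \<le> v \<bullet> (X *v v)}"

definition Lambda_plus :: "nat \<Rightarrow> (real^'n^'n) set" where
  "Lambda_plus r = {X \<in> psd_cone. rank X \<le> r}"

section \<open>Singular values\<close>

definition charpoly :: "real^'n^'n \<Rightarrow> real poly" where
  "charpoly A = det (mat [:0, 1:] - (\<chi> i j. [:A $ i $ j:]))"

text \<open>The singular values of X are the square roots of the eigenvalues of the Gram matrix
  of X, repeated according to multiplicity and sorted in descending order;
  \<open>sing_val X i\<close> is the i-th largest, with i counted from 1 to n.\<close>

definition sing_vals :: "real^'n^'n \<Rightarrow> real list" where
  "sing_vals X = rev (sorted_list_of_multiset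
     (image_mset sqrt (proots (charpoly (transpose X ** X)))))"

definition sing_val :: "real^'n^'n \<Rightarrow> nat \<Rightarrow> real" where
  "sing_val X i = sing_vals X ! (i - 1)"

definition nuclear_norm :: "real^'n^'n \<Rightarrow> real" where
  "nuclear_norm X = (\<Sum>i=1..CARD('n). sing_val X i)"

definition ky_fan_norm :: "nat \<Rightarrow> real^'n^'n \<Rightarrow> real" where
  "ky_fan_norm r X = (\<Sum>i=1..r. sing_val X i)"

section \<open>Variational analysis\<close>

text \<open>Unlike \<^const>\<open>infdist\<close>, this distance is infinite for the empty set.\<close>

definition edist :: "'a::metric_space \<Rightarrow> 'a set \<Rightarrow> ennreal" where
  "edist x C = (INF y\<in>C. ennreal (dist x y))"

lemma edist_empty: "edist x {} = \<infinity>"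
  by (simp add: edist_def)

lemma edist_nonempty:
  assumes "C \<noteq> {}"
  shows "edist x C = ennreal (infdist x C)"
proof (rule antisym)
  show "ennreal (infdist x C) \<le> edist x C"
    unfolding edist_def by (auto intro!: INF_greatest ennreal_leI infdist_le)
  show "edist x C \<le> ennreal (infdist x C)"
  proof (rule ennreal_le_epsilon)
    fix e :: real assume "0 < e"
    then have "infdist x C < infdist x C + e" by simp
    then obtain y where y: "y \<in> C" "dist x y < infdist x C + e"
      using cINF_less_iff[OF assms, of "dist x" "infdist x C + e"]
      by (auto simp: infdist_notempty[OF assms])
    have "edist x C \<le> ennreal (dist x y)"
      unfolding edist_def using y(1) by (rule INF_lower)
    also have "\<dots> \<le> ennreal (infdist x C) + ennreal e"
      using y(2) \<open>0 < e\<close> by (simp flip: ennreal_plus add: infdist_nonneg ennreal_leI)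
    finally show "edist x C \<le> ennreal (infdist x C) + ennreal e" .
  qed
qed

text \<open>The spaces between which a multifunction acts are given explicitly, as subspaces
  \<open>Y\<close> and \<open>Z\<close> of the ambient types; balls are taken within these subspaces.\<close>

definition calm ::
  "'y::euclidean_space set \<Rightarrow> 'z::euclidean_space set \<Rightarrow> ('y \<Rightarrow> 'z set) \<Rightarrow> 'y \<Rightarrow> 'z \<Rightarrow> bool" where
  "calm Y Z M ybar zbar \<longleftrightarrow>
     ybar \<in> Y \<and> zbar \<in> M ybar \<and>
     (\<exists>\<gamma>\<ge>0. \<exists>\<epsilon>>0. \<exists>\<delta>>0. \<forall>y\<in>Y. norm (y - ybar) \<le> \<epsilon> \<longrightarrow>
        M y \<inter> (cball zbar \<delta> \<inter> Z) \<subseteq>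
        {z + (\<gamma> * norm (y - ybar)) *\<^sub>R b | z b. z \<in> M ybar \<and> b \<in> cball 0 1 \<inter> Z})"

text \<open>In \<^typ>\<open>ennreal\<close>, zero times infinity is zero; as \<open>\<kappa>\<close> may be enlarged,
  the notion does not depend on that convention.\<close>

definition subregular ::
  "'z::euclidean_space set \<Rightarrow> ('z \<Rightarrow> 'y::euclidean_space set) \<Rightarrow> 'z \<Rightarrow> 'y \<Rightarrow> bool" where
  "subregular Z F zbar ybar \<longleftrightarrow>
     zbar \<in> Z \<and> ybar \<in> F zbar \<and>
     (\<exists>\<kappa>::real\<ge>0. \<exists>\<epsilon>>0. \<forall>z \<in> cball zbar \<epsilon> \<inter> Z.
        edist z {w \<in> Z. ybar \<in> F w} \<le> ennreal \<kappa> * edist ybar (F z))"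

text \<open>Normal cones to a subset \<open>S\<close> of a subspace \<open>E\<close>, taken within \<open>E\<close>. At an isolated
  point of \<open>S\<close> the upper limit is minus infinity, so that every vector is normal.\<close>

definition frechet_normal_cone ::
  "'a::euclidean_space set \<Rightarrow> 'a set \<Rightarrow> 'a \<Rightarrow> 'a set" where
  "frechet_normal_cone E S xbar =
     {v \<in> E. Limsup (at xbar within S)
        (\<lambda>x. ereal (v \<bullet> (x - xbar) / norm (x - xbar))) \<le> 0}"

definition limiting_normal_cone ::
  "'a::euclidean_space set \<Rightarrow> 'a set \<Rightarrow> 'a \<Rightarrow> 'a set" where
  "limiting_normal_cone E S xbar =
     {v \<in> E. \<exists>x w. (\<forall>k::nat. x k \<in> S \<and> w k \<in> frechet_normal_cone E S (x k)) \<and>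
        x \<longlonglongrightarrow> xbar \<and> w \<longlonglongrightarrow> v}"

section \<open>The rank-constrained set and its multifunctions\<close>

definition Omega :: "(real^'n^'n) set \<Rightarrow> (real^'n^'n) set" where
  "Omega \<Xi> = psd_cone \<inter> \<Xi>"

definition Gamma_r :: "(real^'n^'n) set \<Rightarrow> nat \<Rightarrow> (real^'n^'n) set" where
  "Gamma_r \<Xi> r = {X \<in> Omega \<Xi>. rank X \<le> r}"

definition S_r :: "(real^'n^'n) set \<Rightarrow> nat \<Rightarrow> real \<Rightarrow> (real^'n^'n) set" where
  "S_r \<Xi> r \<tau> = {X \<in> Omega \<Xi>. nuclear_norm X - ky_fan_norm r X = \<tau>}"

definition G_r ::
  "(real^'n^'n) set \<Rightarrow> nat \<Rightarrow> (real^'n^'n) \<times> (real^'n^'n) \<Rightarrow> (real^'n^'n) set" where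
  "G_r \<Xi> r = (\<lambda>(X, Y). if (X, Y) \<in> \<Xi> \<times> Lambda_plus r then {X - Y} else {})"

end

theory Submission
  imports Defs
begin

text \<open>
Two ideas carry the proof; write \<open>gap X\<close> for the difference of the nuclear norm and the
Ky-Fan norm.

First, on the semidefinite cone \<open>gap X\<close> and the distance of \<open>X\<close> to \<open>Lambda_plus r\<close> are
equivalent up to constants. There the singular values are the eigenvalues
(\<open>psd_spectral_decomposition\<close>), and the gap is the sum of the smallest ones. Cutting off the
spectral sum gives \<open>dist \<le> gap\<close> (\<open>psd_low_rank_approximation\<close>), and comparing quadratic
forms on a vector in the kernel of a matrix of rank at most \<open>r\<close> gives \<open>gap \<le> n * dist\<close>
(\<open>ky_fan_gap_le_dist_low_rank\<close>). Calmness of \<open>S_r\<close> is a bound of the distance to \<open>Gamma_r\<close> by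
the gap on \<open>Omega\<close> (\<open>S_r_calm_iff_error_bound\<close>). So it says the same as condition (i)
restricted to \<open>Omega\<close>, where the distance to \<open>\<Xi>\<close> vanishes, and the additional
hypothesis on \<open>\<Xi>\<close> and the semidefinite cone serves to pass from \<open>Omega\<close> to all nearby
matrices by projection.

Second, conditions (i) and (ii) both express that near \<open>Xbar\<close> the distance of \<open>a\<close> to
\<open>\<Xi> \<inter> Lambda_plus r\<close> is at most a multiple of \<open>dist a b\<close> for \<open>a \<in> \<Xi>\<close> and
\<open>b \<in> Lambda_plus r\<close>, an equivalence that holds for any two closed sets in place of \<open>\<Xi>\<close> and
\<open>Lambda_plus r\<close>. So does the implication from the normal cone condition to this estimate: from pairs that violate the estimate with growing
constants, minimising \<open>dist a b\<close> with a quadratic penalty produces almost opposite unit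
normals at points tending to \<open>Xbar\<close>, and a limit of them contradicts the condition
(\<open>normal_qualification_imp_pair_regular\<close>).
\<close>

section \<open>Spectral theorem for symmetric matrices\<close>

text \<open>The form \<open>g x = m * (x \<bullet> x) - x \<bullet> f x\<close> is nonnegative on \<open>S\<close> and vanishes at \<open>u\<close>, so its
derivative at \<open>u\<close> vanishes in every direction of \<open>S\<close>. The residual \<open>w = f u - m *\<^sub>R u\<close> is
itself such a direction, and the derivative along it is \<open>- 2 * (w \<bullet> w)\<close>.\<close>

lemma quadratic_maximiser_is_eigenvector:
  fixes f :: "'a::euclidean_space \<Rightarrow> 'a"
  assumes lin: "linear f" and sa: "\<And>x y. x \<bullet> f y = f x \<bullet> y"
    and S: "subspace S" "f ` S \<subseteq> S" and u: "u \<in> S" "u \<bullet> f u = m * (u \<bullet> u)"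
    and max: "\<And>x. x \<in> S \<Longrightarrow> x \<bullet> f x \<le> m * (x \<bullet> x)"
  shows "f u = m *\<^sub>R u"
proof -
  interpret f: linear f by (rule lin)
  define w where "w = f u - m *\<^sub>R u"
  define g where "g = (\<lambda>x. m * (x \<bullet> x) - x \<bullet> f x)"
  have w: "w \<in> S"
    unfolding w_def using S u by (auto intro: subspace_diff subspace_scale)
  have g0: "0 \<le> g x" if "x \<in> S" for x
    using max[OF that] by (simp add: g_def)
  have expand: "g (u + t *\<^sub>R w) = t\<^sup>2 * g w - 2 * t * (w \<bullet> w)" for t
  proof -
    have "g (u + t *\<^sub>R w) = g u + t\<^sup>2 * g w + 2 * t * (m * (u \<bullet> w) - f u \<bullet> w)"
      using sa[of u w]
      by (simp add: g_def f.add f.scale inner_simps power2_eq_square algebra_simps inner_commute)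
    moreover have "m * (u \<bullet> w) - f u \<bullet> w = - (w \<bullet> w)"
      by (simp add: w_def inner_simps algebra_simps inner_commute)
    ultimately show ?thesis using u by (simp add: g_def)
  qed
  have "w \<bullet> w \<le> 0"
  proof (rule ccontr)
    assume "\<not> w \<bullet> w \<le> 0"
    then have pos: "w \<bullet> w > 0" by (simp only: not_le)
    \<comment> \<open>a step so short that the quadratic term of \<open>g\<close> cannot outweigh the linear one; the summand 1 avoids division by zero\<close>
    define t where "t = (w \<bullet> w) / (g w + 1)"
    have gw: "0 \<le> g w" by (rule g0[OF w])
    then have t: "t > 0" "t * g w \<le> w \<bullet> w"
      using pos by (auto simp: t_def field_simps)
    have "u + t *\<^sub>R w \<in> S"
      using S u w by (auto intro: subspace_add subspace_scale)
    then have "0 \<le> t * (t * g w - 2 * (w \<bullet> w))"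
      using g0[of "u + t *\<^sub>R w"] by (simp add: expand power2_eq_square algebra_simps)
    then have "2 * (w \<bullet> w) \<le> t * g w"
      using t by (simp add: zero_le_mult_iff)
    with t pos show False by linarith
  qed
  then have "w = 0" by (metis inner_eq_zero_iff inner_ge_zero order_antisym)
  then show ?thesis by (simp add: w_def)
qed

lemma selfadjoint_has_unit_eigenvector:
  fixes f :: "'a::euclidean_space \<Rightarrow> 'a"
  assumes lin: "linear f" and sa: "\<And>x y. x \<bullet> f y = f x \<bullet> y"
    and S: "subspace S" "f ` S \<subseteq> S" and ne: "S \<noteq> {0}"
  obtains u m where "u \<in> S" "norm u = 1" "f u = m *\<^sub>R u"
proof -
  define K where "K = S \<inter> sphere 0 1"
  have "compact K"
    unfolding K_def using closed_subspace[OF S(1)] by (simp add: closed_Int_compact)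
  moreover have "K \<noteq> {}"
  proof -
    obtain x where x: "x \<in> S" "x \<noteq> 0"
      using ne subspace_0[OF S(1)] by auto
    then have "x /\<^sub>R norm x \<in> K"
      using S(1) by (auto simp: K_def intro: subspace_scale)
    then show ?thesis by blast
  qed
  moreover have "continuous_on K (\<lambda>x. x \<bullet> f x)"
    using lin by (intro continuous_intros linear_continuous_on) (simp add: linear_conv_bounded_linear)
  ultimately obtain u where u: "u \<in> K" and max: "\<And>x. x \<in> K \<Longrightarrow> x \<bullet> f x \<le> u \<bullet> f u"
    by (meson continuous_attains_sup)
  have "x \<bullet> f x \<le> (u \<bullet> f u) * (x \<bullet> x)" if x: "x \<in> S" for x
  proof (cases "x = 0")
    case False
    then have "x /\<^sub>R norm x \<in> K"
      using x S(1) by (auto simp: K_def intro: subspace_scale)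
    from max[OF this] have "(x \<bullet> f x) / (norm x)\<^sup>2 \<le> u \<bullet> f u"
      using linear_scale[OF lin] by (simp add: power2_eq_square field_simps)
    then show ?thesis
      using False by (simp add: pos_divide_le_eq power2_norm_eq_inner)
  qed simp
  moreover have "u \<in> S" "norm u = 1" using u by (auto simp: K_def)
  moreover have "u \<bullet> u = 1" using \<open>norm u = 1\<close> by (simp add: norm_eq_1)
  ultimately have "f u = (u \<bullet> f u) *\<^sub>R u"
    by (intro quadratic_maximiser_is_eigenvector[OF lin sa S]) auto
  with that \<open>u \<in> S\<close> \<open>norm u = 1\<close> show ?thesis by blast
qed

text \<open>A unit eigenvector \<open>u\<close> splits off: by self-adjointness \<open>f\<close> also maps the orthogonal complement
of \<open>u\<close> in \<open>S\<close> to itself, and the dimension drops by one.\<close>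

theorem selfadjoint_orthonormal_eigenbasis:
  fixes f :: "'a::euclidean_space \<Rightarrow> 'a"
  assumes lin: "linear f" and sa: "\<And>x y. x \<bullet> f y = f x \<bullet> y"
    and "subspace S" "f ` S \<subseteq> S"
  shows "\<exists>B. B \<subseteq> S \<and> pairwise orthogonal B \<and> (\<forall>b\<in>B. norm b = 1 \<and> (\<exists>c. f b = c *\<^sub>R b)) \<and> card B = dim S"
  using assms(3,4)
proof (induction "dim S" arbitrary: S rule: less_induct)
  case (less S)
  show ?case
  proof (cases "S = {0}")
    case True
    then show ?thesis by (intro exI[of _ "{}"]) simp
  next
    case False
    then obtain u m where u: "u \<in> S" "norm u = 1" "f u = m *\<^sub>R u"
      using selfadjoint_has_unit_eigenvector[OF lin sa less.prems] by blast
    define S' where "S' = {y \<in> S. \<forall>x \<in> span {u}. orthogonal x y}"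
    have S'_alt: "S' = {y \<in> S. u \<bullet> y = 0}"
      by (auto simp: S'_def orthogonal_def span_singleton)
    have "dim S' + dim (span {u}) = dim S"
      unfolding S'_def using less.prems(1) u(1)
      by (intro dim_subspace_orthogonal_to_vectors subspace_span span_minimal) auto
    moreover have "u \<noteq> 0" using u(2) by auto
    ultimately have dim: "dim S' + 1 = dim S"
      by simp
    have sub: "subspace S'"
      using less.prems(1) unfolding S'_alt subspace_def by (auto simp: inner_simps)
    have "f ` S' \<subseteq> S'"
      using less.prems(2) u(3) sa[of u] by (auto simp: S'_alt)
    with less.hyps[of S'] dim sub obtain B where B: "B \<subseteq> S'" "pairwise orthogonal B"
      "\<And>b. b \<in> B \<Longrightarrow> norm b = 1 \<and> (\<exists>c. f b = c *\<^sub>R b)" "card B = dim S'"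
      by auto
    have "finite B"
      using B(2,3) by (intro finiteI_independent pairwise_orthogonal_independent) force+
    moreover have "u \<notin> B"
      using B(1) \<open>u \<noteq> 0\<close> by (auto simp: S'_alt)
    moreover have "pairwise orthogonal (insert u B)"
      using B(1,2) by (auto simp: pairwise_insert orthogonal_def S'_alt inner_commute)
    ultimately show ?thesis
      using u B dim by (intro exI[of _ "insert u B"]) (auto simp: S'_alt)
  qed
qed

definition outer :: "real^'n \<Rightarrow> real^'n \<Rightarrow> real^'n^'n" where
  "outer u v = (\<chi> i j. u $ i * v $ j)"

lemma outer_mult_vec: "outer u v *v x = (v \<bullet> x) *\<^sub>R u"
  by (simp add: outer_def matrix_vector_mult_def inner_vec_def vec_eq_iff sum_distrib_left
      sum_distrib_right mult_ac)

lemma norm_outer: "norm (outer u v) = norm u * norm v"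
proof -
  have "outer u v = (\<chi> i. u $ i *\<^sub>R v)" by (simp add: outer_def vec_eq_iff)
  then have "norm (outer u v) = L2_set (\<lambda>i. norm v * norm (u $ i)) UNIV"
    by (subst norm_vec_def) (simp add: mult.commute)
  then show ?thesis
    by (simp add: L2_set_right_distrib[symmetric] norm_vec_def[of u] mult.commute)
qed

lemma transpose_outer: "transpose (outer u v) = outer v u"
  by (simp add: outer_def transpose_def vec_eq_iff mult.commute)

lemma matrix_vector_mult_sum_left: "sum A I *v x = (\<Sum>i\<in>I. A i *v (x::real^'n))"
  by (induction I rule: infinite_finite_induct)
    (auto simp: matrix_vector_mult_add_rdistrib)

lemma transpose_sum: "transpose (sum A I) = (\<Sum>i\<in>I. transpose (A i :: real^'n^'m))"
  by (simp add: transpose_def vec_eq_iff)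

lemma transpose_scale: "transpose (c *\<^sub>R (A :: real^'n^'m)) = c *\<^sub>R transpose A"
  by (simp add: transpose_def vec_eq_iff)

lemma quadratic_form_eq_inner_outer: "v \<bullet> (A *v v) = A \<bullet> outer v v"
  by (simp add: inner_vec_def matrix_vector_mult_def outer_def sum_distrib_left mult_ac)

lemma quadratic_form_bound: "\<bar>v \<bullet> (A *v v)\<bar> \<le> norm A * (v \<bullet> v)" for A :: "real^'n^'n"
  using Cauchy_Schwarz_ineq2[of A "outer v v"]
  by (simp add: quadratic_form_eq_inner_outer norm_outer flip: power2_norm_eq_inner power2_eq_square)

definition orthonormal_on :: "'b set \<Rightarrow> ('b \<Rightarrow> 'a::real_inner) \<Rightarrow> bool" where
  "orthonormal_on I q \<longleftrightarrow> (\<forall>i\<in>I. \<forall>j\<in>I. q i \<bullet> q j = (if i = j then 1 else 0))"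

lemma sym_spectral_decomposition:
  fixes X :: "real^'n^'n"
  assumes "X \<in> sym_mats"
  obtains q :: "'n \<Rightarrow> real^'n" and d
  where "orthonormal_on UNIV q" "\<And>i. X *v q i = d i *\<^sub>R q i"
proof -
  have "x \<bullet> (X *v y) = (X *v x) \<bullet> y" for x y
    using assms by (metis (mono_tags) dot_lmul_matrix mem_Collect_eq sym_mats_def transpose_matrix_vector)
  then obtain B where B: "pairwise orthogonal B"
    "\<And>b. b \<in> B \<Longrightarrow> norm b = 1 \<and> (\<exists>c. X *v b = c *\<^sub>R b)" "card B = CARD('n)"
    using selfadjoint_orthonormal_eigenbasis[of "(*v) X" UNIV]
    by (auto simp: matrix_vector_mul_linear)
  have "finite B"
    using B(1,2) by (intro finiteI_independent pairwise_orthogonal_independent) force+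
  then obtain q where q: "bij_betw q (UNIV :: 'n set) B"
    using B(3) by (metis finite_same_card_bij finite)
  then have qB: "q i \<in> B" for i by (auto simp: bij_betw_def)
  have inj: "inj q" using q by (simp add: bij_betw_def)
  have "orthonormal_on UNIV q"
    using B(1) qB B(2) inj unfolding orthonormal_on_def pairwise_def orthogonal_def
    by (auto simp: norm_eq_1 inj_eq)
  moreover obtain d where "\<And>i. X *v q i = d i *\<^sub>R q i"
    using B(2)[OF qB] by metis
  ultimately show ?thesis using that by blast
qed

section \<open>Singular values of positive semidefinite matrices\<close>

lemma sum_const_poly: "[:\<Sum>i\<in>I. c i:] = (\<Sum>i\<in>I. [:c i:])"
proof (induction I rule: infinite_finite_induct)
  case (insert x F)
  have "[:c x + sum c F:] = [:c x:] + [:sum c F:]" by simp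
  with insert show ?case by simp
qed simp_all

lemma matrix_mult_diff_distrib:
  fixes A B C :: "'a::ring_1^'n^'n"
  shows "A ** (B - C) = A ** B - A ** C" "(B - C) ** A = B ** A - C ** A"
  by (simp_all add: matrix_matrix_mult_def vec_eq_iff algebra_simps sum_subtractf)

lemma const_poly_matrix_mult:
  fixes A B :: "'a::comm_ring_1^'n^'n"
  shows "(\<chi> i j. [:(A ** B) $ i $ j:]) = (\<chi> i j. [:A $ i $ j:]) ** (\<chi> i j. [:B $ i $ j:])"
  by (simp add: vec_eq_iff matrix_matrix_mult_def sum_const_poly mult.commute)

text \<open>Conjugation by \<open>Q\<close> can be carried out over the polynomial ring: the indeterminate times the
identity is central, so it passes through the constant matrices obtained from \<open>Q\<close> and its
transpose, whose determinants multiply to one.\<close>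

lemma charpoly_orthogonal_diag:
  fixes Q :: "real^'n^'n"
  assumes "orthogonal_matrix Q"
  shows "charpoly (Q ** (\<chi> i j. if i = j then c i else 0) ** transpose Q) = (\<Prod>i\<in>UNIV. [:- c i, 1:])"
proof -
  define P where "P A = (\<chi> i j. [:A $ i $ j:])" for A :: "real^'n^'n"
  define D :: "real^'n^'n" where "D = (\<chi> i j. if i = j then c i else 0)"
  have Pm: "P (A ** B) = P A ** P B" for A B
    unfolding P_def by (rule const_poly_matrix_mult)
  have "P (mat 1) = mat 1"
    by (simp add: P_def mat_def vec_eq_iff one_pCons)
  then have PQ: "P Q ** P (transpose Q) = mat 1"
    using assms by (simp add: orthogonal_matrix_def flip: Pm)
  have cent: "M ** mat [:0, 1:] = mat [:0, 1:] ** M" for M :: "real poly^'n^'n"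
    by (simp add: matrix_matrix_mult_def mat_def vec_eq_iff if_distrib if_distribR sum.delta mult.commute cong: if_cong)
  have "mat [:0, 1:] = P Q ** mat [:0, 1:] ** P (transpose Q)"
    by (simp add: cent PQ flip: matrix_mul_assoc)
  then have "mat [:0, 1:] - P (Q ** D ** transpose Q) = P Q ** (mat [:0, 1:] - P D) ** P (transpose Q)"
    by (simp add: Pm matrix_mult_diff_distrib)
  then have "charpoly (Q ** D ** transpose Q) = det (P Q) * det (mat [:0, 1:] - P D) * det (P (transpose Q))"
    by (simp add: charpoly_def P_def det_mul)
  also have "\<dots> = det (P Q ** P (transpose Q)) * det (mat [:0, 1:] - P D)"
    by (simp add: det_mul mult_ac)
  also have "\<dots> = det (mat [:0, 1:] - P D)"
    by (simp add: PQ)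
  also have "\<dots> = (\<Prod>i\<in>UNIV. [:- c i, 1:])"
    by (subst det_diagonal) (auto simp: mat_def P_def D_def)
  finally show ?thesis by (simp add: D_def)
qed

lemma proots_linear_product:
  fixes c :: "'b::finite \<Rightarrow> 'a::idom"
  shows "proots (\<Prod>i\<in>UNIV. [:- c i, 1:]) = image_mset c (mset_set UNIV)"
proof -
  have "proots (\<Prod>i\<in>UNIV. [:- c i, 1:]) = (\<Sum>i\<in>UNIV. {#c i#})"
    by (subst proots_prod) auto
  also have "\<dots> = image_mset c (mset_set UNIV)"
    by (simp add: sum_unfold_sum_mset)
  finally show ?thesis .
qed

text \<open>The Gram matrix \<open>X\<^sup>2\<close> has the eigenvectors of \<open>X\<close> and the squared eigenvalues. Since these
eigenvalues are nonnegative, the square root in the definition of the singular values undoes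
the square, so that the singular values are the eigenvalues.\<close>

lemma sing_vals_psd_eq:
  fixes X :: "real^'n^'n" and q :: "'n \<Rightarrow> real^'n"
  assumes q: "orthonormal_on UNIV q" and d: "\<And>i. X *v q i = d i *\<^sub>R q i"
    and X: "X \<in> sym_mats" and nonneg: "\<And>i. 0 \<le> d i"
  shows "sing_vals X = rev (sorted_list_of_multiset (image_mset d (mset_set UNIV)))"
proof -
  define Q :: "real^'n^'n" where "Q = (\<chi> i j. q j $ i)"
  have "transpose Q ** Q = mat 1"
    using q by (simp add: Q_def orthonormal_on_def matrix_matrix_mult_def transpose_def mat_def
        inner_vec_def vec_eq_iff)
  then have Q: "orthogonal_matrix Q"
    by (simp add: orthogonal_matrix)
  have "X ** (X ** Q) = Q ** (\<chi> i j. if i = j then (d i)\<^sup>2 else 0)"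
  proof -
    have "X ** (X ** Q) = (\<chi> i j. (X *v (X *v q j)) $ i)"
      by (simp add: matrix_matrix_mult_def matrix_vector_mult_def Q_def)
    also have "\<dots> = (\<chi> i j. (d j)\<^sup>2 * q j $ i)"
      by (simp add: d matrix_vector_mult_scaleR power2_eq_square)
    also have "\<dots> = Q ** (\<chi> i j. if i = j then (d i)\<^sup>2 else 0)"
      by (simp add: Q_def matrix_matrix_mult_def if_distrib sum.delta mult.commute cong: if_cong)
    finally show ?thesis .
  qed
  then have "X ** X ** (Q ** transpose Q) = Q ** (\<chi> i j. if i = j then (d i)\<^sup>2 else 0) ** transpose Q"
    by (simp add: matrix_mul_assoc)
  then have "transpose X ** X = Q ** (\<chi> i j. if i = j then (d i)\<^sup>2 else 0) ** transpose Q"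
    using Q X by (simp add: orthogonal_matrix_def sym_mats_def)
  then have "charpoly (transpose X ** X) = (\<Prod>i\<in>UNIV. [:- (d i)\<^sup>2, 1:])"
    using charpoly_orthogonal_diag[OF Q] by simp
  then show ?thesis
    using nonneg by (simp add: sing_vals_def proots_linear_product multiset.map_comp o_def)
qed

lemma sort_map_eq_map_sort_key: "sort (map d xs) = map d (sort_key d xs)"
  by (rule properties_for_sort) (simp_all add: mset_map)

text \<open>An orthonormal eigenbasis in which the \<open>i\<close>-th vector belongs to the \<open>i\<close>-th largest singular
value. Sorting the index type by eigenvalue, instead of sorting the eigenvalues, keeps track
of the eigenvectors.\<close>

theorem psd_spectral_decomposition:
  fixes X :: "real^'n^'n"
  assumes "X \<in> psd_cone"
  obtains q :: "nat \<Rightarrow> real^'n"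
  where "orthonormal_on {1..CARD('n)} q"
    and "\<And>i. i \<in> {1..CARD('n)} \<Longrightarrow> X *v q i = sing_val X i *\<^sub>R q i"
    and "\<And>i. i \<in> {1..CARD('n)} \<Longrightarrow> 0 \<le> sing_val X i"
    and "\<And>i j. 1 \<le> i \<Longrightarrow> i \<le> j \<Longrightarrow> j \<le> CARD('n) \<Longrightarrow> sing_val X j \<le> sing_val X i"
proof -
  have X: "X \<in> sym_mats" using assms by (simp add: psd_cone_def)
  then obtain p :: "'n \<Rightarrow> real^'n" and d where
    p: "orthonormal_on UNIV p" and d: "\<And>i. X *v p i = d i *\<^sub>R p i"
    using sym_spectral_decomposition by blast
  have nonneg: "0 \<le> d i" for i
  proof -
    have "0 \<le> p i \<bullet> (X *v p i)" using assms by (simp add: psd_cone_def)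
    then show ?thesis using p by (simp add: d orthonormal_on_def)
  qed
  obtain us :: "'n list" where us: "set us = UNIV" "distinct us"
    using finite_distinct_list[of "UNIV :: 'n set"] by auto
  define ys where "ys = rev (sort_key d us)"
  have ys: "set ys = UNIV" "distinct ys" using us by (auto simp: ys_def)
  then have len: "length ys = CARD('n)" by (metis distinct_card)
  have "mset us = mset_set UNIV" using us by (metis mset_set_set)
  then have "image_mset d (mset_set UNIV) = mset (map d us)" by simp
  then have "sing_vals X = rev (sort (map d us))"
    using sing_vals_psd_eq[OF p d X nonneg] by (metis sorted_list_of_multiset_mset)
  then have sv: "sing_vals X = map d ys"
    by (simp add: sort_map_eq_map_sort_key ys_def rev_map)
  have sval: "sing_val X i = d (ys ! (i - 1))" if "i \<in> {1..CARD('n)}" for i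
  proof -
    have "i - 1 < length ys" using that len by auto
    then show ?thesis by (simp add: sing_val_def sv)
  qed
  have sorted: "sorted (rev (map d ys))"
    by (simp add: ys_def rev_map)
  show ?thesis
  proof (rule that[of "\<lambda>i. p (ys ! (i - 1))"])
    show "orthonormal_on {1..CARD('n)} (\<lambda>i. p (ys ! (i - 1)))"
      using p ys len by (auto simp: orthonormal_on_def nth_eq_iff_index_eq)
    show "sing_val X j \<le> sing_val X i" if "1 \<le> i" "i \<le> j" "j \<le> CARD('n)" for i j
      using that len sorted_rev_nth_mono[OF sorted, of "i - 1" "j - 1"] by (simp add: sval)
  qed (simp_all add: sval d nonneg)
qed

lemma sing_val_antimono:
  fixes X :: "real^'n^'n"
  assumes "X \<in> psd_cone" "1 \<le> i" "i \<le> j" "j \<le> CARD('n)"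
  shows "sing_val X j \<le> sing_val X i"
  by (rule psd_spectral_decomposition[OF assms(1)]) (use assms(2-4) in blast)

lemma orthonormal_on_subset: "orthonormal_on I q \<Longrightarrow> J \<subseteq> I \<Longrightarrow> orthonormal_on J q"
  unfolding orthonormal_on_def by blast

lemma orthonormal_on_dim_span:
  fixes q :: "'b \<Rightarrow> 'a::euclidean_space"
  assumes "orthonormal_on I q" "finite I"
  shows "dim (span (q ` I)) = card I"
proof -
  have "inj_on q I"
    using assms(1) unfolding orthonormal_on_def inj_on_def by (metis zero_neq_one)
  moreover have "pairwise orthogonal (q ` I)"
    using assms(1) by (force simp: orthonormal_on_def pairwise_def orthogonal_def)
  moreover have "0 \<notin> q ` I"
    using assms(1) by (force simp: orthonormal_on_def)
  ultimately show ?thesis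
    by (simp add: card_image dim_eq_card_independent pairwise_orthogonal_independent)
qed

lemma span_orthonormal_expansion:
  fixes q :: "'b \<Rightarrow> 'a::euclidean_space"
  assumes "orthonormal_on I q" "finite I" "x \<in> span (q ` I)"
  shows "x = (\<Sum>i\<in>I. (q i \<bullet> x) *\<^sub>R q i)"
  using assms(3)
proof (induction rule: span_induct_alt)
  case base
  then show ?case by simp
next
  case (step c b y)
  then obtain j where j: "j \<in> I" "b = q j" by auto
  have "(\<Sum>i\<in>I. (q i \<bullet> b) *\<^sub>R q i) = (\<Sum>i\<in>I. if i = j then q i else 0)"
    using assms(1) j by (intro sum.cong) (auto simp: orthonormal_on_def)
  then have b: "(\<Sum>i\<in>I. (q i \<bullet> b) *\<^sub>R q i) = b"
    using j assms(2) by simp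
  have "(\<Sum>i\<in>I. (q i \<bullet> (c *\<^sub>R b + y)) *\<^sub>R q i)
      = c *\<^sub>R (\<Sum>i\<in>I. (q i \<bullet> b) *\<^sub>R q i) + (\<Sum>i\<in>I. (q i \<bullet> y) *\<^sub>R q i)"
    by (simp add: inner_add_right scaleR_add_left sum.distrib scaleR_sum_right)
  with step.IH b show ?case by simp
qed

lemma orthonormal_spans_UNIV:
  fixes q :: "nat \<Rightarrow> real^'n"
  assumes "orthonormal_on {1..CARD('n)} q"
  shows "span (q ` {1..CARD('n)}) = UNIV"
  using orthonormal_on_dim_span[OF assms] dim_eq_full[of "q ` {1..CARD('n)}"] by simp

definition spectral_sum :: "'b set \<Rightarrow> ('b \<Rightarrow> real) \<Rightarrow> ('b \<Rightarrow> real^'n) \<Rightarrow> real^'n^'n" where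
  "spectral_sum I s q = (\<Sum>i\<in>I. s i *\<^sub>R outer (q i) (q i))"

lemma spectral_sum_mult_vec: "spectral_sum I s q *v x = (\<Sum>i\<in>I. (s i * (q i \<bullet> x)) *\<^sub>R q i)"
  by (simp add: spectral_sum_def matrix_vector_mult_sum_left outer_mult_vec scaleR_matrix_vector_assoc[symmetric])

lemma spectral_sum_psd:
  assumes "\<And>i. i \<in> I \<Longrightarrow> 0 \<le> s i"
  shows "spectral_sum I s q \<in> psd_cone"
proof -
  have "spectral_sum I s q \<in> sym_mats"
    by (simp add: sym_mats_def spectral_sum_def transpose_sum transpose_scale transpose_outer)
  moreover have "x \<bullet> (spectral_sum I s q *v x) = (\<Sum>i\<in>I. s i * (q i \<bullet> x)\<^sup>2)" for x
    by (simp add: spectral_sum_mult_vec inner_sum_right power2_eq_square mult_ac inner_commute)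
  ultimately show ?thesis
    using assms by (simp add: psd_cone_def sum_nonneg)
qed

lemma spectral_sum_rank:
  assumes "finite I"
  shows "rank (spectral_sum I s q) \<le> card I"
proof -
  have "range ((*v) (spectral_sum I s q)) \<subseteq> span (q ` I)"
    by (auto simp: spectral_sum_mult_vec intro!: span_sum span_scale intro: span_base)
  then have "rank (spectral_sum I s q) \<le> dim (span (q ` I))"
    unfolding rank_dim_range by (rule dim_subset)
  also have "\<dots> \<le> card (q ` I)"
    using assms by (simp add: dim_le_card')
  finally show ?thesis using card_image_le[OF assms, of q] by linarith
qed

section \<open>The Ky-Fan gap and the distance to low rank\<close>

definition ky_fan_gap :: "nat \<Rightarrow> real^'n^'n \<Rightarrow> real" where
  "ky_fan_gap r X = nuclear_norm X - ky_fan_norm r X"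

lemma ky_fan_gap_eq_tail:
  fixes X :: "real^'n^'n"
  assumes "r \<le> CARD('n)"
  shows "ky_fan_gap r X = (\<Sum>i=r+1..CARD('n). sing_val X i)"
  using sum.ub_add_nat[of 1 r "sing_val X" "CARD('n) - r"] assms
  by (simp add: ky_fan_gap_def nuclear_norm_def ky_fan_norm_def)

text \<open>Cut the spectral sum of \<open>X\<close> after \<open>r\<close> terms. What is removed is a sum of rank-one matrices
whose norms are exactly the singular values that make up the gap.\<close>

lemma psd_low_rank_approximation:
  fixes X :: "real^'n^'n"
  assumes X: "X \<in> psd_cone" and r: "r \<le> CARD('n)"
  obtains Y where "Y \<in> Lambda_plus r" "norm (X - Y) \<le> ky_fan_gap r X"
proof -
  obtain q :: "nat \<Rightarrow> real^'n" where q: "orthonormal_on {1..CARD('n)} q"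
    and ev: "\<And>i. i \<in> {1..CARD('n)} \<Longrightarrow> X *v q i = sing_val X i *\<^sub>R q i"
    and nonneg: "\<And>i. i \<in> {1..CARD('n)} \<Longrightarrow> 0 \<le> sing_val X i"
    and mono: "\<And>i j. 1 \<le> i \<Longrightarrow> i \<le> j \<Longrightarrow> j \<le> CARD('n) \<Longrightarrow> sing_val X j \<le> sing_val X i"
    by (rule psd_spectral_decomposition[OF X]) blast
  define Y where "Y = spectral_sum {1..r} (sing_val X) q"
  have unit: "norm (q i) = 1" if "i \<in> {1..CARD('n)}" for i
    using q that by (simp add: orthonormal_on_def norm_eq_1)
  have "X *v x = spectral_sum {1..CARD('n)} (sing_val X) q *v x" for x
  proof -
    have "X *v x = X *v (\<Sum>i=1..CARD('n). (q i \<bullet> x) *\<^sub>R q i)"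
      using span_orthonormal_expansion[OF q, of x] orthonormal_spans_UNIV[OF q] by simp
    also have "\<dots> = (\<Sum>i=1..CARD('n). (q i \<bullet> x) *\<^sub>R (X *v q i))"
      by (simp add: linear_sum[OF matrix_vector_mul_linear] matrix_vector_mult_scaleR)
    also have "\<dots> = spectral_sum {1..CARD('n)} (sing_val X) q *v x"
      by (simp add: spectral_sum_mult_vec ev mult.commute)
    finally show ?thesis .
  qed
  then have "X = spectral_sum {1..CARD('n)} (sing_val X) q"
    by (simp add: matrix_eq)
  also have "\<dots> = Y + spectral_sum {r+1..CARD('n)} (sing_val X) q"
    unfolding Y_def spectral_sum_def
    using sum.ub_add_nat[of 1 r "\<lambda>i. sing_val X i *\<^sub>R outer (q i) (q i)" "CARD('n) - r"] r by simp
  finally have "X - Y = spectral_sum {r+1..CARD('n)} (sing_val X) q"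
    by (metis add_diff_cancel_left')
  then have "norm (X - Y) = norm (spectral_sum {r+1..CARD('n)} (sing_val X) q)"
    by simp
  also have "\<dots> \<le> (\<Sum>i=r+1..CARD('n). norm (sing_val X i *\<^sub>R outer (q i) (q i)))"
    unfolding spectral_sum_def by (rule norm_sum)
  also have "\<dots> = ky_fan_gap r X"
    unfolding ky_fan_gap_eq_tail[OF r] using q nonneg unit
    by (intro sum.cong) (auto simp: norm_outer)
  finally have "norm (X - Y) \<le> ky_fan_gap r X" .
  moreover have "Y \<in> Lambda_plus r"
    using spectral_sum_psd[of "{1..r}" "sing_val X" q] spectral_sum_rank[of "{1..r}" "sing_val X" q] nonneg r
    by (auto simp: Lambda_plus_def Y_def)
  ultimately show ?thesis using that by blast
qed

text \<open>Weyl's inequality in a special case. The first \<open>r + 1\<close> eigenvectors span a space too large for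
\<open>Y\<close> to be injective on it; a vector \<open>v\<close> of this space with \<open>Y *v v = 0\<close> sees in \<open>X - Y\<close> only
\<open>X\<close>, whose quadratic form is at least \<open>sing_val X (r + 1) * (v \<bullet> v)\<close> there.\<close>

lemma sing_val_le_dist_low_rank:
  fixes X :: "real^'n^'n"
  assumes X: "X \<in> psd_cone" and r: "r < CARD('n)" and Y: "rank Y \<le> r"
  shows "sing_val X (r + 1) \<le> norm (X - Y)"
proof -
  obtain q :: "nat \<Rightarrow> real^'n" where q: "orthonormal_on {1..CARD('n)} q"
    and ev: "\<And>i. i \<in> {1..CARD('n)} \<Longrightarrow> X *v q i = sing_val X i *\<^sub>R q i"
    and nonneg: "\<And>i. i \<in> {1..CARD('n)} \<Longrightarrow> 0 \<le> sing_val X i"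
    and mono: "\<And>i j. 1 \<le> i \<Longrightarrow> i \<le> j \<Longrightarrow> j \<le> CARD('n) \<Longrightarrow> sing_val X j \<le> sing_val X i"
    by (rule psd_spectral_decomposition[OF X]) blast
  define W where "W = span (q ` {1..r+1})"
  have q': "orthonormal_on {1..r+1} q"
    using r by (intro orthonormal_on_subset[OF q]) auto
  have "dim W = r + 1"
    unfolding W_def using orthonormal_on_dim_span[OF q'] by simp
  moreover have "dim ((*v) Y ` W) \<le> r"
    using Y dim_subset[OF image_mono[OF subset_UNIV], of "(*v) Y" W] by (simp add: rank_dim_range)
  ultimately have "\<not> inj_on ((*v) Y) (span W)"
    using dim_image_eq[of "(*v) Y" W] by (auto simp: matrix_vector_mul_linear)
  then obtain a b where "a \<in> W" "b \<in> W" "a \<noteq> b" "Y *v a = Y *v b"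
    by (auto simp only: inj_on_def W_def span_span)
  then obtain v where v: "v \<in> W" "v \<noteq> 0" "Y *v v = 0"
    unfolding W_def by (metis span_diff matrix_vector_mult_diff_distrib eq_iff_diff_eq_0)
  have vexp: "v = (\<Sum>i=1..r+1. (q i \<bullet> v) *\<^sub>R q i)"
    using span_orthonormal_expansion[OF q'] v(1) unfolding W_def by blast
  have vv: "v \<bullet> v = (\<Sum>i=1..r+1. (q i \<bullet> v)\<^sup>2)"
    by (subst (2) vexp) (simp only: inner_sum_right inner_scaleR_right power2_eq_square inner_commute)
  have "X *v v = (\<Sum>i=1..r+1. (q i \<bullet> v) *\<^sub>R (sing_val X i *\<^sub>R q i))"
  proof -
    have "X *v v = (\<Sum>i=1..r+1. X *v ((q i \<bullet> v) *\<^sub>R q i))"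
      by (subst vexp) (rule linear_sum[OF matrix_vector_mul_linear])
    also have "\<dots> = (\<Sum>i=1..r+1. (q i \<bullet> v) *\<^sub>R (sing_val X i *\<^sub>R q i))"
      using r by (intro sum.cong) (auto simp: matrix_vector_mult_scaleR ev)
    finally show ?thesis .
  qed
  then have "v \<bullet> (X *v v) = (\<Sum>i=1..r+1. sing_val X i * (q i \<bullet> v)\<^sup>2)"
    by (simp only: inner_sum_right inner_scaleR_right power2_eq_square inner_commute mult_ac)
  moreover have "sing_val X (r+1) * (v \<bullet> v) \<le> (\<Sum>i=1..r+1. sing_val X i * (q i \<bullet> v)\<^sup>2)"
    unfolding vv sum_distrib_left using r by (intro sum_mono mult_right_mono mono) auto
  ultimately have "sing_val X (r+1) * (v \<bullet> v) \<le> v \<bullet> ((X - Y) *v v)"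
    using v(3) by (simp add: matrix_vector_mult_diff_rdistrib)
  also have "\<dots> \<le> norm (X - Y) * (v \<bullet> v)"
    using quadratic_form_bound[of v "X - Y"] by linarith
  finally show ?thesis using v(2) by simp
qed

text \<open>Each of the at most \<open>CARD('n)\<close> summands of the gap is bounded by the largest one, which is
\<open>sing_val X (r + 1)\<close>.\<close>

lemma ky_fan_gap_le_dist_low_rank:
  fixes X :: "real^'n^'n"
  assumes X: "X \<in> psd_cone" and r: "r \<le> CARD('n)" and Y: "Y \<in> Lambda_plus r"
  shows "ky_fan_gap r X \<le> CARD('n) * norm (X - Y)"
proof -
  have "ky_fan_gap r X \<le> (\<Sum>i=r+1..CARD('n). norm (X - Y))"
    unfolding ky_fan_gap_eq_tail[OF r]
  proof (rule sum_mono)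
    fix i assume i: "i \<in> {r+1..CARD('n)}"
    then have "sing_val X i \<le> sing_val X (r + 1)"
      by (intro sing_val_antimono[OF X]) auto
    also have "\<dots> \<le> norm (X - Y)"
      using i Y by (intro sing_val_le_dist_low_rank[OF X]) (auto simp: Lambda_plus_def)
    finally show "sing_val X i \<le> norm (X - Y)" .
  qed
  also have "\<dots> \<le> CARD('n) * norm (X - Y)"
    by (simp add: mult_right_mono)
  finally show ?thesis .
qed

lemma ky_fan_gap_nonneg:
  fixes X :: "real^'n^'n"
  assumes "X \<in> psd_cone" "r \<le> CARD('n)"
  shows "0 \<le> ky_fan_gap r X"
  by (rule psd_low_rank_approximation[OF assms]) (use norm_ge_zero order_trans in blast)

lemma Lambda_plus_eq_gap_zero:
  assumes "r \<le> CARD('n)"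
  shows "Lambda_plus r = {X \<in> psd_cone. ky_fan_gap r (X :: real^'n^'n) = 0}"
proof safe
  fix X :: "real^'n^'n" assume X: "X \<in> Lambda_plus r"
  then show "X \<in> psd_cone" by (simp add: Lambda_plus_def)
  with X show "ky_fan_gap r X = 0"
    using ky_fan_gap_le_dist_low_rank[OF _ assms X, of X] ky_fan_gap_nonneg[OF _ assms, of X]
    by (simp add: Lambda_plus_def)
next
  fix X :: "real^'n^'n" assume "X \<in> psd_cone" "ky_fan_gap r X = 0"
  then show "X \<in> Lambda_plus r"
    by (elim psd_low_rank_approximation[OF _ assms]) simp
qed

lemma subspace_sym_mats: "subspace (sym_mats :: (real^'n^'n) set)"
  by (auto simp: subspace_def sym_mats_def transpose_def vec_eq_iff)

lemma closed_psd_cone: "closed (psd_cone :: (real^'n^'n) set)"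
proof -
  have eq: "psd_cone = sym_mats \<inter> (\<Inter>v. {X :: real^'n^'n. 0 \<le> outer v v \<bullet> X})"
    by (auto simp: psd_cone_def quadratic_form_eq_inner_outer inner_commute)
  have "closed {X :: real^'n^'n. 0 \<le> outer v v \<bullet> X}" for v :: "real^'n"
    using closed_halfspace_ge[of 0 "outer v v"] by simp
  then show ?thesis
    unfolding eq by (simp add: closed_Int closed_INT closed_subspace subspace_sym_mats)
qed

text \<open>Limits of low-rank matrices have gap zero by the upper estimate of the gap, and gap zero
forces low rank because the gap bounds the distance to a matrix of rank at most \<open>r\<close>.\<close>

lemma closed_Lambda_plus:
  assumes r: "r \<le> CARD('n)"
  shows "closed (Lambda_plus r :: (real^'n^'n) set)"
proof -
  have "X \<in> Lambda_plus r" if X: "X \<in> closure (Lambda_plus r)" for X :: "real^'n^'n"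
  proof -
    have "closure (Lambda_plus r) \<subseteq> (psd_cone :: (real^'n^'n) set)"
      by (intro closure_minimal closed_psd_cone) (auto simp: Lambda_plus_def)
    with X have psd: "X \<in> psd_cone" by blast
    have "ky_fan_gap r X \<le> 0 + e" if "e > 0" for e
    proof -
      have "0 < e / CARD('n)" using \<open>e > 0\<close> by simp
      then obtain Y where Y: "Y \<in> Lambda_plus r" "dist Y X < e / CARD('n)"
        using X unfolding closure_approachable by blast
      have "ky_fan_gap r X \<le> CARD('n) * norm (X - Y)"
        by (rule ky_fan_gap_le_dist_low_rank[OF psd r Y(1)])
      also have "\<dots> \<le> CARD('n) * (e / CARD('n))"
        using Y(2) by (intro mult_left_mono) (simp_all add: dist_norm norm_minus_commute)
      finally show ?thesis by simp
    qed
    then have "ky_fan_gap r X \<le> 0" by (rule field_le_epsilon)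
    with ky_fan_gap_nonneg[OF psd r] have "ky_fan_gap r X = 0" by linarith
    with psd show ?thesis unfolding Lambda_plus_eq_gap_zero[OF r] by blast
  qed
  then show ?thesis by (intro closure_subset_eq[THEN iffD1] subsetI)
qed

section \<open>Normal cones and regularity of the intersection of two sets\<close>

lemma gradient_at_minimiser_normal:
  fixes g :: "'a::euclidean_space \<Rightarrow> real"
  assumes der: "(g has_derivative (\<lambda>h. w \<bullet> h)) (at a)" and w: "- w \<in> E"
    and min: "\<forall>\<^sub>F x in at a within S. g a \<le> g x"
  shows "- w \<in> frechet_normal_cone E S a"
proof -
  have "Limsup (at a within S) (\<lambda>x. ereal (- w \<bullet> (x - a) / norm (x - a))) \<le> 0 + ereal e"
    if "e > 0" for e
  unfolding add_0
  proof (rule Limsup_bounded)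
    have "\<forall>\<^sub>F x in at a within S. norm (g x - g a - w \<bullet> (x - a)) \<le> e * norm (x - a)"
      using der[THEN has_derivative_at_withinI[of g _ a S]] \<open>e > 0\<close>
      by (simp add: has_derivative_within_alt2)
    moreover have "\<forall>\<^sub>F x in at a within S. x \<noteq> a"
      by (simp add: eventually_at_filter)
    ultimately show "\<forall>\<^sub>F x in at a within S. ereal (- w \<bullet> (x - a) / norm (x - a)) \<le> ereal e"
      using min
    proof eventually_elim
      case (elim x)
      then have "- w \<bullet> (x - a) \<le> e * norm (x - a)" by simp
      moreover have "0 < norm (x - a)" using elim by simp
      ultimately show ?case by (simp only: ereal_less_eq pos_divide_le_eq)
    qed
  qed
  then have "Limsup (at a within S) (\<lambda>x. ereal (- w \<bullet> (x - a) / norm (x - a))) \<le> 0"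
    by (rule ereal_le_epsilon2)
  with w show ?thesis by (simp add: frechet_normal_cone_def)
qed

text \<open>The gradient of the distance to \<open>b\<close> plus a quadratic penalty. The penalty is squared because
it then has a gradient even at its centre \<open>p\<close>, and minimisers yield exact Frechet normals rather
than approximate ones.\<close>

lemma penalised_distance_has_derivative:
  fixes a b p :: "'a::euclidean_space"
  assumes "a \<noteq> b"
  shows "((\<lambda>x. norm (x - b) + c * (norm (x - p))\<^sup>2) has_derivative
      (\<lambda>h. (sgn (a - b) + (2 * c) *\<^sub>R (a - p)) \<bullet> h)) (at a)"
  unfolding power2_norm_eq_inner
  by (rule derivative_eq_intros has_derivative_compose[OF _ has_derivative_norm] refl | simp add: assms)+
    (auto simp: fun_eq_iff inner_simps inner_commute algebra_simps)

lemma limiting_normal_coneI: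
  assumes "subspace E" and "\<And>k. x k \<in> S" and w: "\<And>k. w k \<in> frechet_normal_cone E S (x k)"
    and "x \<longlonglongrightarrow> z" "w \<longlonglongrightarrow> v"
  shows "v \<in> limiting_normal_cone E S z"
proof -
  have "w k \<in> E" for k using w by (simp add: frechet_normal_cone_def)
  then have "v \<in> E"
    by (rule closed_sequentially[OF closed_subspace[OF assms(1)] _ assms(5)])
  with assms show ?thesis unfolding limiting_normal_cone_def by blast
qed

text \<open>A pair of points whose mutual distance is small compared with the distance to the
intersection gives nearly opposite unit normals. Minimise
\<open>norm (x - y) + c * (norm (x - a))\<^sup>2 + c * (norm (y - b))\<^sup>2\<close> over \<open>A \<times> B\<close>. The value at
\<open>(a, b)\<close> is \<open>t = dist a b\<close>, so the minimiser \<open>(a', b')\<close> stays within \<open>sqrt (t / c)\<close> of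
\<open>(a, b)\<close>, too near to lie on the diagonal of \<open>A \<inter> B\<close>. Hence \<open>a' \<noteq> b'\<close>, the distance is
differentiable there with the two opposite unit vectors as gradients, and the penalty
contributes at most \<open>2 * sqrt (c * t)\<close> to each of them.\<close>

lemma approximate_intersection_normals:
  fixes A B :: "'a::euclidean_space set"
  assumes E: "subspace E" "A \<subseteq> E" "B \<subseteq> E" and cl: "closed A" "closed B"
    and ab: "a \<in> A" "b \<in> B" and k: "0 < k"
    and far: "k * dist a b < infdist a (A \<inter> B)"
  obtains a' b' v w1 w2 where "a' \<in> A" "b' \<in> B"
    "dist a' a \<le> infdist a (A \<inter> B)" "dist b' b \<le> infdist a (A \<inter> B)"
    "norm v = 1" "norm w1 \<le> 4 / k" "norm w2 \<le> 4 / k"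
    "- v + w1 \<in> frechet_normal_cone E A a'" "v + w2 \<in> frechet_normal_cone E B b'"
proof -
  define t where "t = dist a b"
  have "a \<noteq> b"
  proof
    assume "a = b"
    with ab have "infdist a (A \<inter> B) = 0" by simp
    with far k show False by (simp add: \<open>a = b\<close>)
  qed
  then have t: "t > 0" by (simp add: t_def)
  \<comment> \<open>this \<open>c\<close> makes \<open>sqrt (t / c)\<close> equal to \<open>k * t / 2\<close> and \<open>2 * sqrt (c * t)\<close> equal to \<open>4 / k\<close>\<close>
  define c where "c = 4 / (k\<^sup>2 * t)"
  have c: "c > 0" using k t by (simp add: c_def)
  define \<phi> where "\<phi> = (\<lambda>(x, y). norm (x - y) + c * (norm (x - a))\<^sup>2 + c * (norm (y - b))\<^sup>2)"
  \<comment> \<open>a compact piece with radius twice \<open>sqrt (t / c)\<close>, so that its boundary does not constrain the minimiser\<close>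
  define K where "K = (A \<inter> cball a (k * t)) \<times> (B \<inter> cball b (k * t))"
  have "compact K"
    unfolding K_def using cl by (intro compact_Times closed_Int_compact compact_cball)
  moreover have abK: "(a, b) \<in> K"
    using ab k t by (simp add: K_def)
  moreover have "continuous_on K \<phi>"
    unfolding \<phi>_def case_prod_beta by (intro continuous_intros)
  ultimately obtain p where p: "p \<in> K" and "\<And>z. z \<in> K \<Longrightarrow> \<phi> p \<le> \<phi> z"
    by (metis continuous_attains_inf empty_iff)
  moreover obtain a' b' where "p = (a', b')" by (cases p)
  ultimately have a'b': "a' \<in> A" "b' \<in> B"
    and min: "\<And>x y. (x, y) \<in> K \<Longrightarrow> \<phi> (a', b') \<le> \<phi> (x, y)" and K': "(a', b') \<in> K"
    by (auto simp: K_def)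
  have "\<phi> (a', b') \<le> t"
    using min[OF abK] by (simp add: \<phi>_def t_def dist_norm)
  then have le_t: "norm (a' - b') + c * (norm (a' - a))\<^sup>2 + c * (norm (b' - b))\<^sup>2 \<le> t"
    by (simp add: \<phi>_def)
  have half: "d \<le> k * t / 2" if "c * d\<^sup>2 \<le> t" for d
  proof (rule power2_le_imp_le)
    show "d\<^sup>2 \<le> (k * t / 2)\<^sup>2"
      using that k t by (simp add: c_def field_simps power2_eq_square)
    show "0 \<le> k * t / 2" using k t by simp
  qed
  have "c * (norm (a' - a))\<^sup>2 \<le> t" "c * (norm (b' - b))\<^sup>2 \<le> t"
    using le_t c by (smt (verit) norm_ge_zero zero_le_power2 mult_nonneg_nonneg)+
  then have near: "norm (a' - a) \<le> k * t / 2" "norm (b' - b) \<le> k * t / 2"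
    by (simp_all only: half)
  have kt: "k * t / 2 < k * t" "k * t < infdist a (A \<inter> B)"
    using k t far by (simp_all add: t_def)
  have "a' \<noteq> b'"
  proof
    assume "a' = b'"
    then have "infdist a (A \<inter> B) \<le> dist a a'"
      using a'b' by (intro infdist_le) auto
    with near kt show False by (simp add: dist_norm norm_minus_commute)
  qed
  define v where "v = sgn (a' - b')"
  have vE: "v \<in> E" and dE: "a' - a \<in> E" "b' - b \<in> E"
    using E a'b' ab unfolding v_def sgn_div_norm
    by (auto intro!: subspace_scale subspace_diff)
  have inball: "\<forall>\<^sub>F x in at z within S. x \<in> cball y (k * t)"
    if "norm (z - y) \<le> k * t / 2" for z y and S :: "'a set"
  proof -
    have "\<forall>\<^sub>F x in at z within S. dist x z < k * t / 2"
      unfolding eventually_at using k t by (intro exI[of _ "k * t / 2"]) auto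
    then show ?thesis
    proof eventually_elim
      case (elim x)
      then show ?case
        using that dist_triangle[of y x z] by (simp add: dist_commute dist_norm norm_minus_commute)
    qed
  qed
  have inS: "\<forall>\<^sub>F x in at z within S. x \<in> S" for z and S :: "'a set"
    by (simp add: eventually_at_filter)
  have nA: "- (v + (2 * c) *\<^sub>R (a' - a)) \<in> frechet_normal_cone E A a'"
  proof (rule gradient_at_minimiser_normal[OF penalised_distance_has_derivative[OF \<open>a' \<noteq> b'\<close>, of c a, folded v_def]])
    show "- (v + (2 * c) *\<^sub>R (a' - a)) \<in> E"
      by (intro subspace_neg subspace_add subspace_scale E(1) vE dE)
    show "\<forall>\<^sub>F x in at a' within A. norm (a' - b') + c * (norm (a' - a))\<^sup>2 \<le> norm (x - b') + c * (norm (x - a))\<^sup>2"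
      using inball[OF near(1), of A] inS[where z = a' and S = A]
    proof eventually_elim
      case (elim x)
      with K' have "(x, b') \<in> K" by (simp add: K_def)
      from min[OF this] show ?case by (simp add: \<phi>_def)
    qed
  qed
  have nB: "- (sgn (b' - a') + (2 * c) *\<^sub>R (b' - b)) \<in> frechet_normal_cone E B b'"
  proof (rule gradient_at_minimiser_normal[OF penalised_distance_has_derivative[OF \<open>a' \<noteq> b'\<close>[symmetric], of c b]])
    have "sgn (b' - a') = - v" unfolding v_def by (metis minus_diff_eq sgn_minus)
    then show "- (sgn (b' - a') + (2 * c) *\<^sub>R (b' - b)) \<in> E"
      by (simp only:) (intro subspace_neg subspace_add subspace_scale E(1) vE dE)
    show "\<forall>\<^sub>F x in at b' within B. norm (b' - a') + c * (norm (b' - b))\<^sup>2 \<le> norm (x - a') + c * (norm (x - b))\<^sup>2"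
      using inball[OF near(2), of B] inS[where z = b' and S = B]
    proof eventually_elim
      case (elim x)
      with K' have "(a', x) \<in> K" by (simp add: K_def)
      from min[OF this] show ?case by (simp add: \<phi>_def norm_minus_commute)
    qed
  qed
  have small: "norm ((2 * c) *\<^sub>R z) \<le> 4 / k" if "norm z \<le> k * t / 2" for z :: 'a
  proof -
    have "norm ((2 * c) *\<^sub>R z) \<le> 2 * c * (k * t / 2)"
      using that c by (simp add: mult_left_mono)
    also have "\<dots> = 4 / k"
      using k t by (simp add: c_def field_simps power2_eq_square)
    finally show ?thesis .
  qed
  show ?thesis
  proof (rule that[of a' b' v "- ((2 * c) *\<^sub>R (a' - a))" "- ((2 * c) *\<^sub>R (b' - b))"])
    show "norm v = 1" using \<open>a' \<noteq> b'\<close> by (simp add: v_def norm_sgn)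
    show "- v + - ((2 * c) *\<^sub>R (a' - a)) \<in> frechet_normal_cone E A a'"
      using nA by simp
    have "sgn (b' - a') = - v" unfolding v_def by (metis minus_diff_eq sgn_minus)
    then show "v + - ((2 * c) *\<^sub>R (b' - b)) \<in> frechet_normal_cone E B b'"
      using nB by simp
  qed (use a'b' near kt small[OF near(1)] small[OF near(2)] in \<open>simp_all add: dist_norm\<close>)
qed

text \<open>Linear regularity of two sets at a common point, tested only at pairs of their own points. This
is the form in which failure produces the pairs needed by the penalisation argument, and it
is also what subregularity of the difference multifunction says.\<close>

definition pair_regular_at :: "'a::metric_space set \<Rightarrow> 'a set \<Rightarrow> 'a \<Rightarrow> bool" where
  "pair_regular_at A B z \<longleftrightarrow> (\<exists>\<kappa>\<ge>0. \<exists>\<epsilon>>0. \<forall>a\<in>A. \<forall>b\<in>B. dist a z \<le> \<epsilon> \<longrightarrow> dist b z \<le> \<epsilon> \<longrightarrow>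
     infdist a (A \<inter> B) \<le> \<kappa> * dist a b)"

text \<open>If regularity fails, then there are pairs tending to \<open>z\<close> that violate it with constants
\<open>k \<rightarrow> \<infinity>\<close>. The opposite unit normals of the preceding lemma have a convergent
subsequence, and its limit is a unit vector in the intersection that the qualification
condition allows to contain only zero.\<close>

theorem normal_qualification_imp_pair_regular:
  fixes A B :: "'a::euclidean_space set"
  assumes E: "subspace E" "A \<subseteq> E" "B \<subseteq> E" and cl: "closed A" "closed B" and z: "z \<in> A \<inter> B"
    and nq: "uminus ` limiting_normal_cone E A z \<inter> limiting_normal_cone E B z \<subseteq> {0}"
  shows "pair_regular_at A B z"
proof (rule ccontr)
  assume not_reg: "\<not> pair_regular_at A B z"
  define P where "P k a b v w1 w2 \<longleftrightarrow> a \<in> A \<and> b \<in> B \<and> dist a z \<le> 2 / Suc k \<and> dist b z \<le> 2 / Suc k \<and>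
      norm v = 1 \<and> norm w1 \<le> 4 / Suc k \<and> norm w2 \<le> 4 / Suc k \<and>
      - v + w1 \<in> frechet_normal_cone E A a \<and> v + w2 \<in> frechet_normal_cone E B b" for k :: nat and a b v w1 w2
  have "\<exists>a b v w1 w2. P k a b v w1 w2" for k
  proof -
    have "\<not> (\<forall>a\<in>A. \<forall>b\<in>B. dist a z \<le> 1 / Suc k \<longrightarrow> dist b z \<le> 1 / Suc k \<longrightarrow>
        infdist a (A \<inter> B) \<le> real (Suc k) * dist a b)"
    proof
      assume "\<forall>a\<in>A. \<forall>b\<in>B. dist a z \<le> 1 / Suc k \<longrightarrow> dist b z \<le> 1 / Suc k \<longrightarrow>
        infdist a (A \<inter> B) \<le> real (Suc k) * dist a b"
      then have "pair_regular_at A B z"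
        unfolding pair_regular_at_def by (intro exI[of _ "real (Suc k)"] conjI exI[of _ "1 / Suc k"]) auto
      with not_reg show False ..
    qed
    then obtain a b where ab: "a \<in> A" "b \<in> B" "dist a z \<le> 1 / Suc k" "dist b z \<le> 1 / Suc k"
      "real (Suc k) * dist a b < infdist a (A \<inter> B)"
      by (auto simp: not_le)
    obtain a' b' v w1 w2 where *: "a' \<in> A" "b' \<in> B"
      "dist a' a \<le> infdist a (A \<inter> B)" "dist b' b \<le> infdist a (A \<inter> B)"
      "norm v = 1" "norm w1 \<le> 4 / Suc k" "norm w2 \<le> 4 / Suc k"
      "- v + w1 \<in> frechet_normal_cone E A a'" "v + w2 \<in> frechet_normal_cone E B b'"
      by (rule approximate_intersection_normals[OF E cl ab(1,2) of_nat_0_less_iff[THEN iffD2, OF zero_less_Suc] ab(5)])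
        blast
    have "infdist a (A \<inter> B) \<le> 1 / Suc k"
      using infdist_le[OF z, of a] ab(3) by linarith
    then have "dist a' z \<le> 2 / Suc k" "dist b' z \<le> 2 / Suc k"
      using *(3,4) ab(3,4) dist_triangle[of a' z a] dist_triangle[of b' z b] by linarith+
    with * have "P k a' b' v w1 w2" by (simp add: P_def)
    then show ?thesis by blast
  qed
  then obtain a b v w1 w2 where P: "\<And>k. P k (a k) (b k) (v k) (w1 k) (w2 k)" by metis
  then have
    ab: "\<And>k. a k \<in> A" "\<And>k. b k \<in> B" "\<And>k. dist (a k) z \<le> 2 / Suc k" "\<And>k. dist (b k) z \<le> 2 / Suc k"
    and v: "\<And>k. norm (v k) = 1"
    and w: "\<And>k. norm (w1 k) \<le> 4 / Suc k" "\<And>k. norm (w2 k) \<le> 4 / Suc k"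
    and normals: "\<And>k. - v k + w1 k \<in> frechet_normal_cone E A (a k)"
      "\<And>k. v k + w2 k \<in> frechet_normal_cone E B (b k)"
    unfolding P_def by blast+
  have null: "(\<lambda>k. C / real (Suc k)) \<longlonglongrightarrow> 0" for C
    using LIMSEQ_Suc[OF lim_const_over_n[of C]] .
  have lim_ab: "a \<longlonglongrightarrow> z" "b \<longlonglongrightarrow> z"
    by (rule metric_tendsto_imp_tendsto[OF null[of 2]], use ab(3,4) in \<open>auto intro!: always_eventually\<close>)+
  have lim_w: "w1 \<longlonglongrightarrow> 0" "w2 \<longlonglongrightarrow> 0"
    by (rule Lim_null_comparison[OF _ null[of 4]], use w in \<open>auto intro!: always_eventually\<close>)+
  have "\<forall>k. v k \<in> sphere 0 1" using v by simp
  then obtain l \<rho> where l: "l \<in> sphere 0 1" and \<rho>: "strict_mono \<rho>" "(v \<circ> \<rho>) \<longlonglongrightarrow> l"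
    using compact_sphere[of "0::'a" 1] unfolding compact_def by metis
  have sub: "(f \<circ> \<rho>) \<longlonglongrightarrow> x" if "f \<longlonglongrightarrow> x" for f and x :: 'a
    using that \<rho>(1) by (rule LIMSEQ_subseq_LIMSEQ)
  have limA: "(\<lambda>k. - v (\<rho> k) + w1 (\<rho> k)) \<longlonglongrightarrow> - l"
    using tendsto_add[OF tendsto_minus[OF \<rho>(2)] sub[OF lim_w(1)]] by (simp add: o_def)
  have limB: "(\<lambda>k. v (\<rho> k) + w2 (\<rho> k)) \<longlonglongrightarrow> l"
    using tendsto_add[OF \<rho>(2) sub[OF lim_w(2)]] by (simp add: o_def)
  have "- l \<in> limiting_normal_cone E A z"
    using E(1) ab(1) normals(1) sub[OF lim_ab(1)] limA
    by (intro limiting_normal_coneI[of E "a \<circ> \<rho>" A "\<lambda>k. - v (\<rho> k) + w1 (\<rho> k)"]) simp_all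
  moreover have "l \<in> limiting_normal_cone E B z"
    using E(1) ab(2) normals(2) sub[OF lim_ab(2)] limB
    by (intro limiting_normal_coneI[of E "b \<circ> \<rho>" B "\<lambda>k. v (\<rho> k) + w2 (\<rho> k)"]) simp_all
  ultimately have "l \<in> {0}" using nq by (force intro: image_eqI[of l uminus "- l"])
  with l show False by simp
qed

text \<open>From pairs to arbitrary points, replace \<open>x\<close> by its projections to \<open>A\<close> and to \<open>B\<close>; their mutual
distance is at most the sum of the two distances of \<open>x\<close>. Conversely, a point of \<open>A\<close> has distance
zero to \<open>A\<close>, and at most \<open>dist a b\<close> to \<open>B\<close>.\<close>

lemma pair_regular_iff_linearly_regular:
  fixes A B :: "'a::heine_borel set"
  assumes AB: "A \<subseteq> E" "B \<subseteq> E" "closed A" "closed B" and z: "z \<in> A \<inter> B"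
  shows "pair_regular_at A B z \<longleftrightarrow>
    (\<exists>\<beta>\<ge>0. \<exists>\<epsilon>>0. \<forall>x\<in>E. dist x z \<le> \<epsilon> \<longrightarrow> infdist x (A \<inter> B) \<le> \<beta> * (infdist x A + infdist x B))"
    (is "_ \<longleftrightarrow> ?lin")
proof
  assume "pair_regular_at A B z"
  then obtain \<kappa> \<epsilon> where \<kappa>: "\<kappa> \<ge> 0" and \<epsilon>: "\<epsilon> > 0" and
    reg: "\<And>a b. a \<in> A \<Longrightarrow> b \<in> B \<Longrightarrow> dist a z \<le> \<epsilon> \<Longrightarrow> dist b z \<le> \<epsilon> \<Longrightarrow> infdist a (A \<inter> B) \<le> \<kappa> * dist a b"
    unfolding pair_regular_at_def by blast
  \<comment> \<open>the radius is halved because projecting may double the distance to \<open>z\<close>\<close>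
  have "infdist x (A \<inter> B) \<le> (1 + \<kappa>) * (infdist x A + infdist x B)" if x: "dist x z \<le> \<epsilon> / 2" for x
  proof -
    obtain a where a: "a \<in> A" "infdist x A = dist x a"
      using infdist_attains_inf[OF AB(3)] z by blast
    obtain b where b: "b \<in> B" "infdist x B = dist x b"
      using infdist_attains_inf[OF AB(4)] z by blast
    have "dist x a \<le> dist x z" "dist x b \<le> dist x z"
      using infdist_le[of z A x] infdist_le[of z B x] z a b by auto
    then have "dist a z \<le> \<epsilon>" "dist b z \<le> \<epsilon>"
      using x dist_triangle3[of a z x] dist_triangle3[of b z x] by linarith+
    with a b have "infdist a (A \<inter> B) \<le> \<kappa> * dist a b" by (intro reg)
    also have "\<dots> \<le> \<kappa> * (dist x a + dist x b)"
      using \<kappa> by (intro mult_left_mono dist_triangle3)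
    finally have "infdist x (A \<inter> B) \<le> \<kappa> * (dist x a + dist x b) + dist x a"
      using infdist_triangle[of x "A \<inter> B" a] by linarith
    then show ?thesis using a b by (simp add: algebra_simps) (smt (verit) zero_le_dist)
  qed
  then show ?lin
    using \<kappa> \<epsilon> by (intro exI[of _ "1 + \<kappa>"] exI[of _ "\<epsilon> / 2"] conjI) auto
next
  assume ?lin
  then obtain \<beta> \<epsilon> where \<beta>: "\<beta> \<ge> 0" and \<epsilon>: "\<epsilon> > 0" and
    lin: "\<And>x. x \<in> E \<Longrightarrow> dist x z \<le> \<epsilon> \<Longrightarrow> infdist x (A \<inter> B) \<le> \<beta> * (infdist x A + infdist x B)"
    by blast
  have "infdist a (A \<inter> B) \<le> \<beta> * dist a b" if "a \<in> A" "b \<in> B" "dist a z \<le> \<epsilon>" for a b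
  proof -
    have "infdist a (A \<inter> B) \<le> \<beta> * (infdist a A + infdist a B)"
      using that AB(1) by (intro lin) auto
    also have "\<dots> \<le> \<beta> * dist a b"
      using that \<beta> infdist_le[of b B a] by (intro mult_left_mono) auto
    finally show ?thesis .
  qed
  with \<beta> \<epsilon> show "pair_regular_at A B z"
    unfolding pair_regular_at_def by blast
qed

text \<open>\<^const>\<open>G_r\<close> for an arbitrary pair of sets.\<close>

definition difference_map :: "'a::real_normed_vector set \<Rightarrow> 'a set \<Rightarrow> 'a \<times> 'a \<Rightarrow> 'a set" where
  "difference_map A B = (\<lambda>(x, y). if (x, y) \<in> A \<times> B then {x - y} else {})"

lemma infdist_lessE:
  assumes "infdist x C < e" "C \<noteq> {}"
  obtains c where "c \<in> C" "dist x c < e"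
  using assms by (auto simp: infdist_notempty cINF_less_iff)

lemma infdist_le_infdist_diagonal:
  fixes x y :: "'a::metric_space"
  assumes "C \<noteq> {}"
  shows "infdist x C \<le> infdist (x, y) ((\<lambda>c. (c, c)) ` C)"
proof -
  have "infdist x C \<le> dist (x, y) (c, c)" if "c \<in> C" for c
    using infdist_le[OF that, of x] dist_fst_le[of "(x, y)" "(c, c)"] by simp
  then show ?thesis
    using assms by (subst (2) infdist_notempty) (auto intro!: cINF_greatest)
qed

lemma dist_Pair_le_sum: "dist (a, b) (c, d) \<le> dist a c + dist b d"
  by (simp add: dist_Pair_Pair sqrt_sum_squares_le_sum)

text \<open>The zeros of the difference multifunction are the diagonal of \<open>A \<inter> B\<close>, and the distance of
\<open>(a, b)\<close> to this diagonal is that of \<open>a\<close> to \<open>A \<inter> B\<close>, up to a factor 2 and the term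
\<open>dist a b\<close>. Outside \<open>A \<times> B\<close> the right-hand side is infinite.\<close>

lemma subregular_difference_map_iff_pair_regular:
  fixes A B :: "'a::euclidean_space set"
  assumes AB: "A \<subseteq> E" "B \<subseteq> E" and z: "z \<in> A \<inter> B"
  shows "subregular (E \<times> E) (difference_map A B) (z, z) 0 \<longleftrightarrow> pair_regular_at A B z"
proof -
  define D where "D = (\<lambda>c. (c, c)) ` (A \<inter> B)"
  have D: "{w \<in> E \<times> E. 0 \<in> difference_map A B w} = D"
    using AB by (auto simp: D_def difference_map_def split: if_splits)
  have "D \<noteq> {}" using z by (auto simp: D_def)
  note edist_D = edist_nonempty[OF this]
  have val: "edist 0 (difference_map A B (a, b)) = ennreal (dist a b)" if "a \<in> A" "b \<in> B" for a b
    using that by (simp add: difference_map_def edist_def dist_norm norm_minus_commute)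
  have zz: "(z, z) \<in> E \<times> E" "0 \<in> difference_map A B (z, z)"
    using z AB by (auto simp: difference_map_def)
  show ?thesis
  proof
    assume "subregular (E \<times> E) (difference_map A B) (z, z) 0"
    then obtain \<kappa> \<epsilon> where \<kappa>: "\<kappa> \<ge> 0" and \<epsilon>: "\<epsilon> > 0" and
      sub: "\<And>p. p \<in> cball (z, z) \<epsilon> \<inter> (E \<times> E) \<Longrightarrow> edist p D \<le> ennreal \<kappa> * edist 0 (difference_map A B p)"
      unfolding subregular_def D by blast
    have "infdist a (A \<inter> B) \<le> \<kappa> * dist a b"
      if ab: "a \<in> A" "b \<in> B" and near: "dist a z \<le> \<epsilon> / 2" "dist b z \<le> \<epsilon> / 2" for a b
    proof -
      have "dist (z, z) (a, b) \<le> dist z a + dist z b"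
        by (rule dist_Pair_le_sum)
      with near have "(a, b) \<in> cball (z, z) \<epsilon> \<inter> (E \<times> E)"
        using ab AB by (auto simp: dist_commute)
      from sub[OF this] have "infdist (a, b) D \<le> \<kappa> * dist a b"
        using \<kappa> by (simp add: edist_D val[OF ab] flip: ennreal_mult)
      moreover have "infdist a (A \<inter> B) \<le> infdist (a, b) D"
        using z unfolding D_def by (intro infdist_le_infdist_diagonal) auto
      ultimately show ?thesis by linarith
    qed
    with \<kappa> \<epsilon> show "pair_regular_at A B z"
      unfolding pair_regular_at_def by (intro exI[of _ \<kappa>] conjI exI[of _ "\<epsilon> / 2"]) auto
  next
    assume "pair_regular_at A B z"
    then obtain \<kappa> \<epsilon> where \<kappa>: "\<kappa> \<ge> 0" and \<epsilon>: "\<epsilon> > 0" and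
      reg: "\<And>a b. a \<in> A \<Longrightarrow> b \<in> B \<Longrightarrow> dist a z \<le> \<epsilon> \<Longrightarrow> dist b z \<le> \<epsilon> \<Longrightarrow> infdist a (A \<inter> B) \<le> \<kappa> * dist a b"
      unfolding pair_regular_at_def by blast
    \<comment> \<open>the summand 1 also makes the constant positive, as zero times infinity is zero in \<^typ>\<open>ennreal\<close>\<close>
    have "edist p D \<le> ennreal (2 * \<kappa> + 1) * edist 0 (difference_map A B p)"
      if p: "p \<in> cball (z, z) \<epsilon> \<inter> (E \<times> E)" for p
    proof (cases "p \<in> A \<times> B")
      case False
      then have "edist 0 (difference_map A B p) = \<infinity>"
        by (auto simp: difference_map_def edist_empty split: prod.split)
      then show ?thesis using \<kappa> by (simp add: ennreal_mult_top)
    next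
      case True
      then obtain a b where ab: "p = (a, b)" "a \<in> A" "b \<in> B" by auto
      have "dist a z \<le> \<epsilon>" "dist b z \<le> \<epsilon>"
        using p ab(1) dist_fst_le[of p "(z, z)"] dist_snd_le[of p "(z, z)"] by (auto simp: dist_commute)
      with ab have r: "infdist a (A \<inter> B) \<le> \<kappa> * dist a b" by (intro reg)
      have "infdist p D \<le> (2 * \<kappa> + 1) * dist a b + e" if "e > 0" for e
      proof -
        obtain c where c: "c \<in> A \<inter> B" "dist a c < \<kappa> * dist a b + e / 2"
          using r z \<open>e > 0\<close> by (elim infdist_lessE[of a "A \<inter> B" "\<kappa> * dist a b + e / 2", rotated -1]) auto
        have "infdist p D \<le> dist (a, b) (c, c)"
          unfolding ab(1) using c by (intro infdist_le) (auto simp: D_def)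
        also have "\<dots> \<le> dist a c + dist b c"
          by (rule dist_Pair_le_sum)
        also have "\<dots> \<le> 2 * dist a c + dist a b"
          using dist_triangle3[of b c a] by simp
        finally show ?thesis using c(2) by (simp add: algebra_simps)
      qed
      then have "infdist p D \<le> (2 * \<kappa> + 1) * dist a b" by (rule field_le_epsilon)
      then have "ennreal (infdist p D) \<le> ennreal ((2 * \<kappa> + 1) * dist a b)" by (rule ennreal_leI)
      also have "\<dots> = ennreal (2 * \<kappa> + 1) * ennreal (dist a b)"
        using \<kappa> by (intro ennreal_mult) auto
      finally show ?thesis
        using ab by (simp only: edist_D val)
    qed
    then show "subregular (E \<times> E) (difference_map A B) (z, z) 0"
      unfolding subregular_def D using zz \<kappa> \<epsilon> by (intro conjI exI[of _ "2 * \<kappa> + 1"] exI[of _ \<epsilon>]) auto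
  qed
qed

section \<open>Calmness of the gap level sets\<close>

lemma edist_le_sum_iff:
  assumes "A \<noteq> {}" "B \<noteq> {}" "C \<noteq> {}" "0 \<le> \<beta>"
  shows "edist x C \<le> ennreal \<beta> * (edist x A + edist x B) \<longleftrightarrow> infdist x C \<le> \<beta> * (infdist x A + infdist x B)"
  using assms by (simp add: edist_nonempty infdist_nonneg flip: ennreal_plus ennreal_mult)

lemma Gamma_r_eq: "Gamma_r \<Xi> r = \<Xi> \<inter> Lambda_plus r"
  by (auto simp: Gamma_r_def Omega_def Lambda_plus_def)

lemma Gamma_r_eq_S_r_zero:
  fixes \<Xi> :: "(real^'n^'n) set"
  assumes "r \<le> CARD('n)"
  shows "Gamma_r \<Xi> r = S_r \<Xi> r 0"
  unfolding Gamma_r_eq Lambda_plus_eq_gap_zero[OF assms] by (auto simp: S_r_def Omega_def ky_fan_gap_def)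

text \<open>Every \<open>X \<in> Omega \<Xi>\<close> lies in exactly one set \<open>S_r \<Xi> r \<tau>\<close>, the one with \<open>\<tau> = ky_fan_gap r X\<close>.
Calmness is therefore a bound of the distance to \<open>Gamma_r \<Xi> r\<close> by the gap. The restriction
to small \<open>\<tau>\<close> in calmness costs nothing, because the gap is small near \<open>Xbar\<close>.\<close>

lemma S_r_calm_iff_error_bound:
  fixes \<Xi> :: "(real^'n^'n) set"
  assumes \<Xi>: "\<Xi> \<subseteq> sym_mats" and r: "r \<le> CARD('n)" and Xbar: "Xbar \<in> Gamma_r \<Xi> r"
  shows "calm UNIV sym_mats (S_r \<Xi> r) 0 Xbar \<longleftrightarrow>
    (\<exists>\<gamma>\<ge>0. \<exists>\<delta>>0. \<forall>X\<in>Omega \<Xi>. dist X Xbar \<le> \<delta> \<longrightarrow> infdist X (Gamma_r \<Xi> r) \<le> \<gamma> * ky_fan_gap r X)"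
proof
  assume "calm UNIV sym_mats (S_r \<Xi> r) 0 Xbar"
  then obtain \<gamma> \<epsilon> \<delta> where \<gamma>: "\<gamma> \<ge> 0" and \<epsilon>: "\<epsilon> > 0" and \<delta>: "\<delta> > 0" and
    calm: "\<And>\<tau>. \<bar>\<tau>\<bar> \<le> \<epsilon> \<Longrightarrow> S_r \<Xi> r \<tau> \<inter> (cball Xbar \<delta> \<inter> sym_mats) \<subseteq>
        {z + (\<gamma> * \<bar>\<tau>\<bar>) *\<^sub>R b | z b. z \<in> S_r \<Xi> r 0 \<and> b \<in> cball 0 1 \<inter> sym_mats}"
    unfolding calm_def by auto
  have "infdist X (Gamma_r \<Xi> r) \<le> \<gamma> * ky_fan_gap r X"
    if X: "X \<in> Omega \<Xi>" "dist X Xbar \<le> min \<delta> (\<epsilon> / CARD('n))" for X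
  proof -
    have psd: "X \<in> psd_cone" using X(1) by (simp add: Omega_def)
    have gap0: "0 \<le> ky_fan_gap r X" by (rule ky_fan_gap_nonneg[OF psd r])
    have "ky_fan_gap r X \<le> CARD('n) * norm (X - Xbar)"
      using Xbar by (intro ky_fan_gap_le_dist_low_rank[OF psd r]) (simp add: Gamma_r_eq)
    also have "\<dots> \<le> CARD('n) * (\<epsilon> / CARD('n))"
      using X(2) by (intro mult_left_mono) (simp_all add: dist_norm)
    finally have "\<bar>ky_fan_gap r X\<bar> \<le> \<epsilon>" using gap0 by simp
    moreover have "X \<in> S_r \<Xi> r (ky_fan_gap r X) \<inter> (cball Xbar \<delta> \<inter> sym_mats)"
      using X \<Xi> by (auto simp: S_r_def ky_fan_gap_def Omega_def dist_commute)
    ultimately obtain Z b where Z: "Z \<in> S_r \<Xi> r 0" and b: "norm b \<le> 1"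
      and eq: "X = Z + (\<gamma> * \<bar>ky_fan_gap r X\<bar>) *\<^sub>R b"
      using calm by force
    have "infdist X (Gamma_r \<Xi> r) \<le> dist X Z"
      using Z by (intro infdist_le) (simp add: Gamma_r_eq_S_r_zero[OF r])
    also have "\<dots> = \<gamma> * ky_fan_gap r X * norm b"
      using eq gap0 \<gamma> by (metis abs_mult abs_of_nonneg add_diff_cancel_left' dist_norm norm_scaleR)
    also have "\<dots> \<le> \<gamma> * ky_fan_gap r X * 1"
      using b gap0 \<gamma> by (intro mult_left_mono) auto
    finally show ?thesis by simp
  qed
  moreover have "min \<delta> (\<epsilon> / CARD('n)) > 0" using \<delta> \<epsilon> by simp
  ultimately show "\<exists>\<gamma>\<ge>0. \<exists>\<delta>>0. \<forall>X\<in>Omega \<Xi>. dist X Xbar \<le> \<delta> \<longrightarrow> infdist X (Gamma_r \<Xi> r) \<le> \<gamma> * ky_fan_gap r X"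
    using \<gamma> by blast
next
  assume "\<exists>\<gamma>\<ge>0. \<exists>\<delta>>0. \<forall>X\<in>Omega \<Xi>. dist X Xbar \<le> \<delta> \<longrightarrow> infdist X (Gamma_r \<Xi> r) \<le> \<gamma> * ky_fan_gap r X"
  then obtain \<gamma> \<delta> where \<gamma>: "\<gamma> \<ge> 0" and \<delta>: "\<delta> > 0" and
    eb: "\<And>X. X \<in> Omega \<Xi> \<Longrightarrow> dist X Xbar \<le> \<delta> \<Longrightarrow> infdist X (Gamma_r \<Xi> r) \<le> \<gamma> * ky_fan_gap r X"
    by blast
  have "\<exists>Z b. X = Z + ((\<gamma> + 1) * norm (\<tau> - 0)) *\<^sub>R b \<and> Z \<in> S_r \<Xi> r 0 \<and> b \<in> cball 0 1 \<inter> sym_mats"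
    if X: "X \<in> S_r \<Xi> r \<tau>" "X \<in> cball Xbar \<delta>" for X \<tau>
  proof (cases "\<tau> = 0")
    case True
    with X(1) subspace_0[OF subspace_sym_mats] show ?thesis by (intro exI[of _ X] exI[of _ 0]) simp
  next
    case False
    have \<Omega>: "X \<in> Omega \<Xi>" and gap: "ky_fan_gap r X = \<tau>"
      using X(1) by (simp_all add: S_r_def ky_fan_gap_def)
    then have "0 \<le> \<tau>"
      using ky_fan_gap_nonneg[OF _ r, of X] by (simp add: Omega_def)
    with False have \<tau>: "\<tau> > 0" by simp
    \<comment> \<open>enlarging \<open>\<gamma>\<close> leaves room for a point of \<open>Gamma_r \<Xi> r\<close> that need not be nearest\<close>
    define m where "m = (\<gamma> + 1) * \<tau>"
    have m: "m > 0" using \<gamma> \<tau> by (simp add: m_def)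
    have "infdist X (Gamma_r \<Xi> r) \<le> \<gamma> * \<tau>"
      using eb[OF \<Omega>] X(2) gap by (simp add: dist_commute)
    also have "\<dots> < m" using \<tau> by (simp add: m_def algebra_simps)
    finally obtain Z where Z: "Z \<in> Gamma_r \<Xi> r" "dist X Z < m"
      using Xbar by (elim infdist_lessE) auto
    have "X \<in> sym_mats" "Z \<in> sym_mats"
      using \<Omega> Z(1) \<Xi> by (auto simp: Omega_def Gamma_r_eq)
    then have "(X - Z) /\<^sub>R m \<in> sym_mats"
      by (intro subspace_scale subspace_diff subspace_sym_mats)
    moreover have "norm ((X - Z) /\<^sub>R m) \<le> 1"
      using Z(2) m by (simp only: norm_scaleR) (simp add: dist_norm field_simps)
    moreover have "X = Z + ((\<gamma> + 1) * norm (\<tau> - 0)) *\<^sub>R ((X - Z) /\<^sub>R m)"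
      using m \<tau> by (simp add: m_def[symmetric])
    ultimately show ?thesis
      using Z(1) by (intro exI[of _ Z] exI[of _ "(X - Z) /\<^sub>R m"]) (simp add: Gamma_r_eq_S_r_zero[OF r])
  qed
  then have "\<forall>\<tau>\<in>UNIV. norm (\<tau> - 0) \<le> (1::real) \<longrightarrow> S_r \<Xi> r \<tau> \<inter> (cball Xbar \<delta> \<inter> sym_mats) \<subseteq>
      {Z + ((\<gamma> + 1) * norm (\<tau> - 0)) *\<^sub>R b | Z b. Z \<in> S_r \<Xi> r 0 \<and> b \<in> cball 0 1 \<inter> sym_mats}"
    by blast
  moreover have "0 \<le> \<gamma> + 1" using \<gamma> by simp
  moreover have "Xbar \<in> S_r \<Xi> r 0"
    using Xbar by (simp add: Gamma_r_eq_S_r_zero[OF r])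
  ultimately show "calm UNIV sym_mats (S_r \<Xi> r) 0 Xbar"
    unfolding calm_def using \<delta> zero_less_one by blast
qed

text \<open>On \<open>Omega \<Xi>\<close> the distance to \<open>\<Xi>\<close> is zero and that to \<open>Lambda_plus r\<close> is at most the gap.\<close>

lemma linear_regularity_imp_error_bound:
  fixes \<Xi> :: "(real^'n^'n) set"
  assumes \<Xi>: "\<Xi> \<subseteq> sym_mats" and r: "r \<le> CARD('n)"
    and lin: "\<exists>\<beta>\<ge>0. \<exists>\<epsilon>>0. \<forall>X\<in>sym_mats. dist X Xbar \<le> \<epsilon> \<longrightarrow>
        infdist X (Gamma_r \<Xi> r) \<le> \<beta> * (infdist X \<Xi> + infdist X (Lambda_plus r))"
  shows "\<exists>\<gamma>\<ge>0. \<exists>\<delta>>0. \<forall>X\<in>Omega \<Xi>. dist X Xbar \<le> \<delta> \<longrightarrow> infdist X (Gamma_r \<Xi> r) \<le> \<gamma> * ky_fan_gap r X"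
proof -
  from lin obtain \<beta> \<epsilon> where \<beta>: "\<beta> \<ge> 0" and \<epsilon>: "\<epsilon> > 0" and
    lin: "\<And>X. X \<in> sym_mats \<Longrightarrow> dist X Xbar \<le> \<epsilon> \<Longrightarrow>
        infdist X (Gamma_r \<Xi> r) \<le> \<beta> * (infdist X \<Xi> + infdist X (Lambda_plus r))"
    by blast
  have "infdist X (Gamma_r \<Xi> r) \<le> \<beta> * ky_fan_gap r X" if X: "X \<in> Omega \<Xi>" "dist X Xbar \<le> \<epsilon>" for X
  proof -
    have X': "X \<in> psd_cone" "X \<in> \<Xi>" using X(1) by (auto simp: Omega_def)
    obtain Y where Y: "Y \<in> Lambda_plus r" "norm (X - Y) \<le> ky_fan_gap r X"
      using psd_low_rank_approximation[OF X'(1) r] .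
    have "infdist X (Lambda_plus r) \<le> ky_fan_gap r X"
      using infdist_le2[OF Y(1)] Y(2) by (simp add: dist_norm)
    moreover have "infdist X \<Xi> = 0" using X'(2) by simp
    ultimately have "\<beta> * (infdist X \<Xi> + infdist X (Lambda_plus r)) \<le> \<beta> * ky_fan_gap r X"
      using \<beta> by (intro mult_left_mono) auto
    moreover have "X \<in> sym_mats" using X'(2) \<Xi> by blast
    ultimately show ?thesis using lin X(2) by (meson order_trans)
  qed
  with \<beta> \<epsilon> show ?thesis by blast
qed

text \<open>Project \<open>X\<close> to a point \<open>Y\<close> of \<open>Omega \<Xi>\<close> and apply the error bound at \<open>Y\<close>. The gap of \<open>Y\<close> is at most
\<open>CARD('n)\<close> times its distance to \<open>Lambda_plus r\<close>, which differs from that of \<open>X\<close> by at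
most \<open>dist X Y\<close>; and \<open>dist X Y\<close> is controlled by the regularity of \<open>\<Xi>\<close> and the semidefinite
cone, of which \<open>Lambda_plus r\<close> is a subset.\<close>

lemma error_bound_imp_linear_regularity:
  fixes \<Xi> :: "(real^'n^'n) set"
  assumes cl: "closed \<Xi>" and r: "r \<le> CARD('n)" and Xbar: "Xbar \<in> Gamma_r \<Xi> r"
    and eb: "\<exists>\<gamma>\<ge>0. \<exists>\<delta>>0. \<forall>X\<in>Omega \<Xi>. dist X Xbar \<le> \<delta> \<longrightarrow> infdist X (Gamma_r \<Xi> r) \<le> \<gamma> * ky_fan_gap r X"
    and psd_reg: "\<exists>\<kappa>>0. \<exists>\<epsilon>>0. \<forall>X\<in>sym_mats. dist X Xbar \<le> \<epsilon> \<longrightarrow>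
        infdist X (Omega \<Xi>) \<le> \<kappa> * (infdist X \<Xi> + infdist X psd_cone)"
  shows "\<exists>\<beta>\<ge>0. \<exists>\<epsilon>>0. \<forall>X\<in>sym_mats. dist X Xbar \<le> \<epsilon> \<longrightarrow>
        infdist X (Gamma_r \<Xi> r) \<le> \<beta> * (infdist X \<Xi> + infdist X (Lambda_plus r))"
proof -
  from eb obtain \<gamma> \<delta> where \<gamma>: "\<gamma> \<ge> 0" and \<delta>: "\<delta> > 0" and
    eb: "\<And>X. X \<in> Omega \<Xi> \<Longrightarrow> dist X Xbar \<le> \<delta> \<Longrightarrow> infdist X (Gamma_r \<Xi> r) \<le> \<gamma> * ky_fan_gap r X"
    by blast
  from psd_reg obtain \<kappa> \<epsilon> where \<kappa>: "\<kappa> > 0" and \<epsilon>: "\<epsilon> > 0" and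
    psd_reg: "\<And>X. X \<in> sym_mats \<Longrightarrow> dist X Xbar \<le> \<epsilon> \<Longrightarrow>
        infdist X (Omega \<Xi>) \<le> \<kappa> * (infdist X \<Xi> + infdist X psd_cone)"
    by blast
  define n where "n = real CARD('n)"
  define c where "c = 1 + \<gamma> * n"
  have n: "n \<ge> 0" by (simp add: n_def)
  have c: "c \<ge> 1" using \<gamma> n by (simp add: c_def)
  have Xbar\<Omega>: "Xbar \<in> Omega \<Xi>" and Xbar\<Lambda>: "Xbar \<in> Lambda_plus r"
    using Xbar by (auto simp: Gamma_r_eq Omega_def Lambda_plus_def)
  have "closed (Omega \<Xi>)"
    unfolding Omega_def using closed_psd_cone cl by (rule closed_Int)
  have "infdist X (Gamma_r \<Xi> r) \<le> (c * \<kappa> + \<gamma> * n) * (infdist X \<Xi> + infdist X (Lambda_plus r))"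
    if X: "X \<in> sym_mats" "dist X Xbar \<le> min \<epsilon> (\<delta> / 2)" for X
  proof -
    obtain Y where Y: "Y \<in> Omega \<Xi>" "infdist X (Omega \<Xi>) = dist X Y"
      using infdist_attains_inf[OF \<open>closed (Omega \<Xi>)\<close>] Xbar\<Omega> by blast
    obtain Z where Z: "Z \<in> Lambda_plus r" "infdist X (Lambda_plus r) = dist X Z"
      using infdist_attains_inf[OF closed_Lambda_plus[OF r]] Xbar\<Lambda> by blast
    have Ypsd: "Y \<in> psd_cone" using Y(1) by (simp add: Omega_def)
    have "dist X Y \<le> dist X Xbar" using infdist_le[OF Xbar\<Omega>, of X] Y(2) by simp
    then have Ynear: "dist Y Xbar \<le> \<delta>"
      using X(2) dist_triangle3[of Y Xbar X] by simp
    have "infdist X psd_cone \<le> infdist X (Lambda_plus r)"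
      using Z(1) unfolding Z(2) by (intro infdist_le) (simp add: Lambda_plus_def)
    moreover have "infdist X (Omega \<Xi>) \<le> \<kappa> * (infdist X \<Xi> + infdist X psd_cone)"
      using X by (intro psd_reg) auto
    moreover from calculation \<kappa> have "\<kappa> * (infdist X \<Xi> + infdist X psd_cone)
        \<le> \<kappa> * (infdist X \<Xi> + infdist X (Lambda_plus r))"
      by (intro mult_left_mono) auto
    ultimately have XY: "dist X Y \<le> \<kappa> * (infdist X \<Xi> + infdist X (Lambda_plus r))"
      using Y(2) by linarith
    have "infdist Y (Gamma_r \<Xi> r) \<le> \<gamma> * ky_fan_gap r Y"
      by (rule eb[OF Y(1) Ynear])
    also have "\<dots> \<le> \<gamma> * (n * dist Y Z)"
      using \<gamma> ky_fan_gap_le_dist_low_rank[OF Ypsd r Z(1)] by (intro mult_left_mono) (simp_all add: n_def dist_norm)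
    also have "\<dots> \<le> \<gamma> * (n * (dist X Y + dist X Z))"
      using \<gamma> n by (intro mult_left_mono dist_triangle3)
    finally have "infdist X (Gamma_r \<Xi> r) \<le> c * dist X Y + \<gamma> * n * infdist X (Lambda_plus r)"
      using infdist_triangle[of X "Gamma_r \<Xi> r" Y] Z(2) by (simp add: c_def algebra_simps)
    also have "\<dots> \<le> c * (\<kappa> * (infdist X \<Xi> + infdist X (Lambda_plus r)))
        + \<gamma> * n * (infdist X \<Xi> + infdist X (Lambda_plus r))"
      using XY c \<gamma> n infdist_nonneg[of X \<Xi>] by (intro add_mono mult_left_mono) auto
    finally show ?thesis by (simp add: algebra_simps)
  qed
  moreover have "0 \<le> c * \<kappa> + \<gamma> * n" "0 < min \<epsilon> (\<delta> / 2)" using c \<kappa> \<gamma> n \<epsilon> \<delta> by auto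
  ultimately show ?thesis by blast
qed

theorem theorem3p2:
  fixes \<Xi> :: "(real^'n^'n) set" and r :: nat and Xbar :: "real^'n^'n"
  assumes "\<Xi> \<subseteq> sym_mats" and "closed \<Xi>"
    and "r \<in> {1..CARD('n)}"
    and "Gamma_r \<Xi> r \<noteq> {}"
    and "Xbar \<in> Gamma_r \<Xi> r"
  defines "cond_i \<equiv> (\<exists>\<beta>::real\<ge>0. \<exists>\<epsilon>>0. \<forall>X\<in>sym_mats. norm (X - Xbar) \<le> \<epsilon> \<longrightarrow>
        edist X (Gamma_r \<Xi> r) \<le> ennreal \<beta> * (edist X \<Xi> + edist X (Lambda_plus r)))"
    and "cond_ii \<equiv> subregular (sym_mats \<times> sym_mats) (G_r \<Xi> r) (Xbar, Xbar) 0"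
    and "S_r_calm \<equiv> calm UNIV sym_mats (S_r \<Xi> r) 0 Xbar"
  shows "
    (cond_i \<longleftrightarrow> cond_ii) \<and>
    (cond_i \<longrightarrow> S_r_calm) \<and>
    (cond_ii \<longrightarrow> S_r_calm) \<and>
    ((\<exists>\<kappa>'::real>0. \<exists>\<epsilon>'>0. \<forall>X\<in>sym_mats. norm (X - Xbar) \<le> \<epsilon>' \<longrightarrow>
        edist X (Omega \<Xi>) \<le> ennreal \<kappa>' * (edist X \<Xi> + edist X psd_cone))
      \<longrightarrow> (S_r_calm \<longleftrightarrow> cond_i) \<and> (S_r_calm \<longleftrightarrow> cond_ii)) \<and>
    (uminus ` limiting_normal_cone sym_mats \<Xi> Xbar
        \<inter> limiting_normal_cone sym_mats (Lambda_plus r) Xbar = {0}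
      \<longrightarrow> S_r_calm)"
proof -
  have r: "r \<le> CARD('n)" using assms(3) by simp
  have Xbar: "Xbar \<in> \<Xi> \<inter> Lambda_plus r" using assms(5) by (simp add: Gamma_r_eq)
  have \<Lambda>: "Lambda_plus r \<subseteq> (psd_cone :: (real^'n^'n) set)" "Lambda_plus r \<subseteq> (sym_mats :: (real^'n^'n) set)"
    by (auto simp: Lambda_plus_def psd_cone_def)
  have ne: "\<Xi> \<noteq> {}" "Lambda_plus r \<noteq> ({} :: (real^'n^'n) set)" "psd_cone \<noteq> ({} :: (real^'n^'n) set)" "Omega \<Xi> \<noteq> {}"
    using Xbar \<Lambda> by (auto simp: Omega_def)
  have i: "cond_i \<longleftrightarrow> (\<exists>\<beta>\<ge>0. \<exists>\<epsilon>>0. \<forall>X\<in>sym_mats. dist X Xbar \<le> \<epsilon> \<longrightarrow>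
      infdist X (Gamma_r \<Xi> r) \<le> \<beta> * (infdist X \<Xi> + infdist X (Lambda_plus r)))"
    unfolding cond_i_def using edist_le_sum_iff[OF ne(1,2) assms(4)] by (simp add: dist_norm cong: conj_cong)
  have i_pair: "cond_i \<longleftrightarrow> pair_regular_at \<Xi> (Lambda_plus r) Xbar"
    unfolding i Gamma_r_eq
    by (rule pair_regular_iff_linearly_regular[OF assms(1) \<Lambda>(2) assms(2) closed_Lambda_plus[OF r] Xbar, symmetric])
  have "G_r \<Xi> r = difference_map \<Xi> (Lambda_plus r)"
    by (simp add: G_r_def difference_map_def)
  then have ii_pair: "cond_ii \<longleftrightarrow> pair_regular_at \<Xi> (Lambda_plus r) Xbar"
    unfolding cond_ii_def by (simp only: subregular_difference_map_iff_pair_regular[OF assms(1) \<Lambda>(2) Xbar])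
  note calm = S_r_calm_iff_error_bound[OF assms(1) r assms(5), folded S_r_calm_def]
  have i_calm: "cond_i \<longrightarrow> S_r_calm"
    unfolding i calm using linear_regularity_imp_error_bound[OF assms(1) r] by blast
  have calm_i: "S_r_calm \<longrightarrow> cond_i"
    if "\<exists>\<kappa>'::real>0. \<exists>\<epsilon>'>0. \<forall>X\<in>sym_mats. norm (X - Xbar) \<le> \<epsilon>' \<longrightarrow>
        edist X (Omega \<Xi>) \<le> ennreal \<kappa>' * (edist X \<Xi> + edist X psd_cone)"
  proof -
    have "\<exists>\<kappa>>0. \<exists>\<epsilon>>0. \<forall>X\<in>sym_mats. dist X Xbar \<le> \<epsilon> \<longrightarrow>
        infdist X (Omega \<Xi>) \<le> \<kappa> * (infdist X \<Xi> + infdist X psd_cone)"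
      using that edist_le_sum_iff[OF ne(1,3,4) less_imp_le] by (simp add: dist_norm cong: conj_cong)
    then show ?thesis
      unfolding i calm using error_bound_imp_linear_regularity[OF assms(2) r assms(5)] by blast
  qed
  have nq_i: "cond_i" if "uminus ` limiting_normal_cone sym_mats \<Xi> Xbar
        \<inter> limiting_normal_cone sym_mats (Lambda_plus r) Xbar = {0}"
    unfolding i_pair using that
    by (intro normal_qualification_imp_pair_regular[OF subspace_sym_mats assms(1) \<Lambda>(2) assms(2)
          closed_Lambda_plus[OF r] Xbar]) simp
  from i_pair ii_pair i_calm calm_i nq_i show ?thesis by blast
qed

end
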